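(* Let $F$ be a fixed graph with $\chi(F)\geq 2$. For every integer $d\geq 1$ and every $\alpha\in(0,1-1/\chi_{\mathrm{cr}}(F))$, restricting to $n$ divisible by $|V(F)|$, the function $n^{-1/d}$ is a $G^d(n,r)$-perturbed threshold for containing an $F$-factor. That is: (1) for every sequence of $n$-vertex graphs $H_n$ with $\delta(H_n)\geq\alpha n$, if $r=\omega(n^{-1/d})$ then $\lim\mathbb{P}[H_n\cup G^d(n,r)\text{ contains an }F\text{-factor}]=1$ as $n\to\infty$ over $n$ divisible by $|V(F)|$; and (2) there exists a sequence of $n$-vertex graphs $H_n$ with $\delta(H_n)\geq\alpha n$ such that, if $r=o(n^{-1/d})$, then $\lim\mathbb{P}[H_n\cup G^d(n,r)\text{ contains an }F\text{-factor}]=0$ as $n\to\infty$ over $n$ divisible by $|V(F)|$.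
   Context: Random geometric graph: let $X_1,\dots,X_n$ be independent uniform random points in $[0,1]^d$; $G^d(n,r)$ is the graph on $[n]$ with edge set $\{\{i,j\}:\|X_i-X_j\|_2\leq r\}$. For an $n$-vertex graph $H_n$ on $[n]$, $H_n\cup G^d(n,r)$ has edge set $E(H_n)\cup\{\{i,j\}:\|X_i-X_j\|_2\leq r\}$. An $F$-factor is a collection of vertex-disjoint copies of $F$ covering all vertices. For a graph $F$ with $\chi(F)\geq2$, the critical chromatic number is $\chi_{\mathrm{cr}}(F)=(\chi(F)-1)\frac{|V(F)|}{|V(F)|-\sigma(F)}$, where $\sigma(F)$ is the minimum, over all proper $\chi(F)$-colourings of $F$, of the size of the smallest colour class. A function $r^*(n)$ is a $G^d(n,r)$-perturbed threshold for a monotone property $P$ (with respect to $\alpha$) if (i) for every $H_n$ with $\delta(H_n)\ge\alpha n$, $\mathbb{P}[H_n\cup G^d(n,r)\in P]\to1$ whenever $r=\omega(r^* )$, and (ii) there is some $H_n$ with $\delta(H_n)\ge\alpha n$ such that $\mathbb{P}[H_n\cup G^d(n,r)\in P]\to0$ whenever $r=o(r^* )$. *)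

theory Defs
  imports "HOL-Probability.Probability" "HOL-Library.Landau_Symbols" "HOL-Library.Ramsey"
begin

text \<open>A finite simple graph is a pair of a vertex set \<open>V\<close> and a set \<open>E\<close> of two-element subsets of \<open>V\<close>.\<close>

definition simple_graph :: "'a set \<Rightarrow> 'a set set \<Rightarrow> bool" where
  "simple_graph V E \<longleftrightarrow> finite V \<and> E \<subseteq> nsets V 2"

definition degree :: "'a set set \<Rightarrow> 'a \<Rightarrow> nat" where
  "degree E v = card {e \<in> E. v \<in> e}"

text \<open>Only meaningful for finite nonempty \<open>V\<close>.\<close>

definition min_degree :: "'a set \<Rightarrow> 'a set set \<Rightarrow> nat" where
  "min_degree V E = (MIN v\<in>V. degree E v)"

definition proper_colouring :: "'a set \<Rightarrow> 'a set set \<Rightarrow> nat \<Rightarrow> ('a \<Rightarrow> nat) \<Rightarrow> bool" where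
  "proper_colouring V E k c \<longleftrightarrow>
     (\<forall>v\<in>V. c v < k) \<and> (\<forall>u\<in>V. \<forall>v\<in>V. {u, v} \<in> E \<longrightarrow> c u \<noteq> c v)"

definition chromatic_number :: "'a set \<Rightarrow> 'a set set \<Rightarrow> nat" where
  "chromatic_number V E = (LEAST k. \<exists>c. proper_colouring V E k c)"

definition smallest_class :: "'a set \<Rightarrow> 'a set set \<Rightarrow> nat" where
  "smallest_class V E =
     (INF c\<in>{c. proper_colouring V E (chromatic_number V E) c}.
        MIN i\<in>{..<chromatic_number V E}. card {v \<in> V. c v = i})"

definition critical_chromatic_number :: "'a set \<Rightarrow> 'a set set \<Rightarrow> real" where
  "critical_chromatic_number V E =
     (real (chromatic_number V E) - 1) *
       (real (card V) / (real (card V) - real (smallest_class V E)))"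

definition isomorphic_copy :: "'a set \<Rightarrow> 'a set set \<Rightarrow> 'b set \<Rightarrow> 'b set set \<Rightarrow> bool" where
  "isomorphic_copy VF EF W D \<longleftrightarrow> (\<exists>\<phi>. bij_betw \<phi> VF W \<and> D = (\<lambda>e. \<phi> ` e) ` EF)"

text \<open>Copies are not required to be induced subgraphs.\<close>

definition has_factor :: "'a set \<Rightarrow> 'a set set \<Rightarrow> 'b set \<Rightarrow> 'b set set \<Rightarrow> bool" where
  "has_factor VF EF V E \<longleftrightarrow>
     (\<exists>C :: ('b set \<times> 'b set set) set.
        (\<forall>(W, D)\<in>C. W \<subseteq> V \<and> D \<subseteq> E \<and> isomorphic_copy VF EF W D) \<and>
        disjoint_family_on fst C \<and> (\<Union>(W, D)\<in>C. W) = V)"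

definition geometric_edges :: "nat \<Rightarrow> real \<Rightarrow> (nat \<Rightarrow> real ^ 'd) \<Rightarrow> nat set set" where
  "geometric_edges n r x =
     {{i, j} | i j. i \<in> {1..n} \<and> j \<in> {1..n} \<and> i \<noteq> j \<and> norm (x i - x j) \<le> r}"

definition uniform_points :: "nat \<Rightarrow> (nat \<Rightarrow> real ^ 'd) measure" where
  "uniform_points n = PiM {1..n} (\<lambda>_. uniform_measure lborel (cbox 0 1))"

definition perturbed_prob ::
  "'d::finite itself \<Rightarrow> (nat set \<Rightarrow> nat set set \<Rightarrow> bool) \<Rightarrow> nat set set \<Rightarrow> nat \<Rightarrow> real \<Rightarrow> real" where
  "perturbed_prob _ P E n r =
     \<P>(x in (uniform_points n :: (nat \<Rightarrow> real ^ 'd) measure). P {1..n} (E \<union> geometric_edges n r x))"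

definition min_degree_sequence :: "nat set \<Rightarrow> real \<Rightarrow> (nat \<Rightarrow> nat set set) \<Rightarrow> bool" where
  "min_degree_sequence N \<alpha> H \<longleftrightarrow>
     (\<forall>n\<in>N. simple_graph {1..n} (H n) \<and> real (min_degree {1..n} (H n)) \<ge> \<alpha> * real n)"

text \<open>
  The filter \<open>inf sequentially (principal N)\<close> expresses \<open>n \<rightarrow> \<infinity>\<close> with \<open>n\<close> ranging over \<open>N\<close>.
  Landau symbols only see absolute values, so nonnegativity of the radius is required separately.
\<close>

definition perturbed_threshold ::
  "'d::finite itself \<Rightarrow> nat set \<Rightarrow> real \<Rightarrow> (nat set \<Rightarrow> nat set set \<Rightarrow> bool) \<Rightarrow> (nat \<Rightarrow> real) \<Rightarrow> bool" where
  "perturbed_threshold d N \<alpha> P rstar \<longleftrightarrow>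
     (\<forall>H. min_degree_sequence N \<alpha> H \<longrightarrow>
        (\<forall>r. (\<forall>n\<in>N. 0 \<le> r n) \<and> r \<in> \<omega>[inf sequentially (principal N)](rstar) \<longrightarrow>
          ((\<lambda>n. perturbed_prob d P (H n) n (r n)) \<longlongrightarrow> 1) (inf sequentially (principal N)))) \<and>
     (\<exists>H. min_degree_sequence N \<alpha> H \<and>
        (\<forall>r. (\<forall>n\<in>N. 0 \<le> r n) \<and> r \<in> o[inf sequentially (principal N)](rstar) \<longrightarrow>
          ((\<lambda>n. perturbed_prob d P (H n) n (r n)) \<longlongrightarrow> 0) (inf sequentially (principal N))))"

end

theory Submission
  imports Defs "HOL-Real_Asymp.Real_Asymp"
begin

text \<open>
  Above the threshold it suffices to tile with cliques on \<open>f = |V(F)|\<close> vertices. Cut the cube into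
  \<open>M \<le> n / K\<close> cells of diameter at most \<open>r\<close>, so that every cell spans a clique of the
  geometric graph, and set aside fewer than \<open>f\<close> leftover vertices per cell to make the remaining
  occupancies divisible by \<open>f\<close>. With high probability every vertex has at least \<open>2 f\<^sup>2\<close>
  \<open>H\<close>-neighbours in all but \<open>M / (2 f)\<close> of the cells. Hence at least half of the cells are rich
  for all vertices in a given group of \<open>f\<close> leftovers, and since there are at most \<open>M\<close> groups,
  each can be given a cell rich for it so that no cell receives more than two groups. Within its
  cell each leftover vertex forms a clique with \<open>f - 1\<close> of its neighbours; a group uses up
  \<open>f (f - 1)\<close> vertices of the cell, which preserves divisibility.

  Below the threshold take for \<open>H\<close> a complete \<open>\<chi>(F)\<close>-partite graph with one class of size at most
  \<open>\<mu> n\<close> for some \<open>\<mu> < \<sigma>(F) / f\<close>. Copies of \<open>F\<close> inside \<open>H\<close> use at least \<open>\<sigma>(F)\<close> vertices of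
  that class, so an \<open>F\<close>-factor needs linearly many geometric edges, whereas their expected number
  is \<open>o(n)\<close>.
\<close>

section \<open>Counting and choosing in finite sets\<close>

lemma card_eq_sum_fibres:
  assumes "finite A" "finite S" "g ` A \<subseteq> S"
  shows "card A = (\<Sum>b\<in>S. card {x \<in> A. g x = b})"
  using sum.group[OF assms, of "\<lambda>_. 1 :: nat"] by simp

lemma card_sparse_fibres_less:
  assumes "finite A" "0 < q"
    and dense: "\<And>S. S \<subseteq> B \<Longrightarrow> card S = q \<Longrightarrow> t * q \<le> card {x \<in> A. g x \<in> S}"
  shows "card {b \<in> B. card {x \<in> A. g x = b} < t} < q"
proof (rule ccontr)
  assume "\<not> ?thesis"
  then obtain S where S: "S \<subseteq> {b \<in> B. card {x \<in> A. g x = b} < t}" "card S = q" "finite S"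
    by (meson not_less obtain_subset_with_card_n)
  have "card {x \<in> A. g x \<in> S} = (\<Sum>b\<in>S. card {x \<in> {x \<in> A. g x \<in> S}. g x = b})"
    using \<open>finite A\<close> \<open>finite S\<close> by (intro card_eq_sum_fibres) auto
  also have "\<dots> = (\<Sum>b\<in>S. card {x \<in> A. g x = b})"
    by (intro sum.cong arg_cong[where f = card]) auto
  also have "\<dots> < (\<Sum>b\<in>S. t)"
    using S \<open>0 < q\<close> by (intro sum_strict_mono) auto
  finally show False using dense[of S] S by (auto simp: mult.commute)
qed

lemma disjoint_subsets_of_card:
  assumes "finite I" "\<And>i. i \<in> I \<Longrightarrow> card I * q \<le> card (A i)"
  obtains S where "\<And>i. i \<in> I \<Longrightarrow> S i \<subseteq> A i" "\<And>i. i \<in> I \<Longrightarrow> card (S i) = q"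
    "\<And>i. i \<in> I \<Longrightarrow> finite (S i)" "disjoint_family_on S I"
proof -
  have "\<exists>S. (\<forall>i\<in>I. S i \<subseteq> A i \<and> card (S i) = q \<and> finite (S i)) \<and> disjoint_family_on S I"
    using assms
  proof (induction I)
    case empty
    then show ?case by (simp add: disjoint_family_on_def)
  next
    case (insert i I)
    have "card I * q \<le> card (A j)" if "j \<in> I" for j
      using insert.prems[of j] insert.hyps that by simp
    with insert.IH obtain S where S: "\<forall>j\<in>I. S j \<subseteq> A j \<and> card (S j) = q \<and> finite (S j)"
      "disjoint_family_on S I" by blast
    have "card (\<Union>j\<in>I. S j) \<le> card I * q"
      using card_UN_le[OF insert.hyps(1), of S] S(1) by simp
    moreover have "card (A i) - card (\<Union>j\<in>I. S j) \<le> card (A i - (\<Union>j\<in>I. S j))"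
      using insert.hyps S by (intro diff_card_le_card_Diff) auto
    moreover have "card I * q + q \<le> card (A i)"
      using insert.prems[of i] insert.hyps by simp
    ultimately have "q \<le> card (A i - (\<Union>j\<in>I. S j))" by linarith
    then obtain T where T: "T \<subseteq> A i - (\<Union>j\<in>I. S j)" "card T = q" "finite T"
      by (rule obtain_subset_with_card_n)
    have "disjoint_family_on (S(i := T)) (insert i I)"
      using S(2) T(1) insert.hyps(2) unfolding disjoint_family_on_def by auto
    moreover have "\<forall>j\<in>insert i I. (S(i := T)) j \<subseteq> A j \<and> card ((S(i := T)) j) = q
        \<and> finite ((S(i := T)) j)"
      using S(1) T by auto
    ultimately show ?case by blast
  qed
  then show ?thesis using that by metis
qed

lemma bounded_multiplicity_choice:
  assumes "finite G" "\<And>g. g \<in> G \<Longrightarrow> card G \<le> m * card (good g)"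
  obtains a where "\<And>g. g \<in> G \<Longrightarrow> a g \<in> good g" "\<And>b. card {g \<in> G. a g = b} \<le> m"
proof -
  have "\<exists>a. (\<forall>g\<in>G. a g \<in> good g) \<and> (\<forall>b. card {g \<in> G. a g = b} \<le> m)"
    using assms
  proof (induction G)
    case empty
    then show ?case by simp
  next
    case (insert g G)
    have "card G \<le> m * card (good h)" if "h \<in> G" for h
      using insert.prems[of h] insert.hyps that by simp
    with insert.IH obtain a where a_good: "\<forall>h\<in>G. a h \<in> good h"
      and a_fibre: "\<forall>b. card {h \<in> G. a h = b} \<le> m"
      by blast
    have room: "card G < m * card (good g)" using insert.prems[of g] insert.hyps by simp
    then have "finite (good g)" by (intro card_ge_0_finite) (cases "card (good g)", auto)
    have "\<exists>b\<in>good g. card {h \<in> G. a h = b} < m"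
    proof (rule ccontr)
      assume "\<not> ?thesis"
      then have "(\<Sum>b\<in>good g. m) \<le> (\<Sum>b\<in>good g. card {h \<in> G. a h = b})"
        by (intro sum_mono) (simp add: not_less)
      also have "\<dots> = card (\<Union>b\<in>good g. {h \<in> G. a h = b})"
        using \<open>finite (good g)\<close> insert.hyps by (intro card_UN_disjoint[symmetric]) auto
      also have "\<dots> \<le> card G" using insert.hyps by (intro card_mono) auto
      finally show False using room by (simp add: mult.commute)
    qed
    then obtain b where "b \<in> good g" and b_fibre: "card {h \<in> G. a h = b} < m" by blast
    have "{h \<in> insert g G. (a(g := b)) h = b} = insert g {h \<in> G. a h = b}"
      "c \<noteq> b \<Longrightarrow> {h \<in> insert g G. (a(g := b)) h = c} = {h \<in> G. a h = c}" for c
      using insert.hyps by auto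
    then have "card {h \<in> insert g G. (a(g := b)) h = c} \<le> m" for c
      using a_fibre b_fibre insert.hyps by (cases "c = b") (simp_all add: Suc_le_eq)
    moreover have "\<forall>h\<in>insert g G. (a(g := b)) h \<in> good h" using a_good \<open>b \<in> good g\<close> by simp
    ultimately show ?case by blast
  qed
  then show ?thesis using that by metis
qed

lemma partition_on_equal_cards:
  assumes "finite A" "0 < f" "f dvd card A"
  obtains P where "partition_on A P" "\<And>K. K \<in> P \<Longrightarrow> card K = f"
proof -
  have "\<exists>P. partition_on A P \<and> (\<forall>K\<in>P. card K = f)"
    using assms
  proof (induction "card A" arbitrary: A rule: less_induct)
    case less
    show ?case
    proof (cases "A = {}")
      case True
      then show ?thesis by (auto simp: partition_on_empty)
    next
      case False
      with less.prems have "f \<le> card A" by (simp add: dvd_imp_le card_gt_0_iff)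
      then obtain K where K: "K \<subseteq> A" "card K = f" "finite K"
        by (rule obtain_subset_with_card_n)
      then have "card (A - K) = card A - f" by (simp add: card_Diff_subset)
      then obtain P where P: "partition_on (A - K) P" "\<forall>K\<in>P. card K = f"
        using less.hyps[of "A - K"] less.prems \<open>f \<le> card A\<close> by auto
      have "K \<noteq> {}" using K \<open>0 < f\<close> by auto
      moreover have "disjnt K (\<Union>P)"
        using partition_onD1[OF P(1)] by (auto simp: disjnt_def)
      ultimately have "partition_on A (insert K P)"
        using P(1) K(1) by (simp add: partition_on_insert)
      then show ?thesis using P(2) K(2) by blast
    qed
  qed
  then show ?thesis using that by blast
qed

lemma card_Union_partition:
  assumes "finite A" "partition_on A P" "\<And>K. K \<in> P \<Longrightarrow> card K = f" "Q \<subseteq> P"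
  shows "card (\<Union>Q) = f * card Q"
proof (rule card_partition[symmetric])
  show "finite Q" using finite_elements[OF assms(1,2)] assms(4) by (rule rev_finite_subset)
  show "finite (\<Union>Q)"
    by (rule finite_subset[OF _ \<open>finite A\<close>]) (use partition_onD1[OF assms(2)] assms(4) in blast)
  show "K \<inter> L = {}" if "K \<in> Q" "L \<in> Q" "K \<noteq> L" for K L
    using partition_onD2[OF assms(2)] assms(4) that by (auto simp: pairwise_def disjnt_def)
qed (use assms(3,4) in blast)

lemma partition_on_obtain_part:
  assumes "partition_on A P"
  obtains part where "\<And>v. v \<in> A \<Longrightarrow> part v \<in> P \<and> v \<in> part v"
    "\<And>v K. K \<in> P \<Longrightarrow> v \<in> K \<Longrightarrow> part v = K"
proof -
  have ex1: "\<exists>!K. K \<in> P \<and> v \<in> K" if "v \<in> A" for v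
    using partition_onD1[OF assms] partition_onD2[OF assms] that
    by (auto simp: pairwise_def disjnt_def)
  show ?thesis
  proof
    show "(THE K. K \<in> P \<and> v \<in> K) \<in> P \<and> v \<in> (THE K. K \<in> P \<and> v \<in> K)" if "v \<in> A" for v
      using ex1[OF that] by (rule theI')
    show "(THE K. K \<in> P \<and> v \<in> K) = K" if "K \<in> P" "v \<in> K" for v K
      using ex1[of v] partition_onD1[OF assms] that by (intro the1_equality) auto
  qed
qed

section \<open>Neighbourhoods and clique tilings\<close>

definition neighbours :: "'b set \<Rightarrow> 'b set set \<Rightarrow> 'b \<Rightarrow> 'b set" where
  "neighbours V E v = {w \<in> V. {v, w} \<in> E}"

lemma degree_eq_card_neighbours:
  assumes "simple_graph V E" "v \<in> V"
  shows "degree E v = card (neighbours V E v)"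
proof -
  have "{e \<in> E. v \<in> e} = (\<lambda>w. {v, w}) ` neighbours V E v"
  proof (intro set_eqI iffI)
    fix e assume e: "e \<in> {e \<in> E. v \<in> e}"
    then have "e \<in> nsets V 2" using assms by (auto simp: simple_graph_def)
    then obtain x y where "e = {x, y}" "x \<in> V" "y \<in> V" "x \<noteq> y" by (rule nsets2_E)
    with e show "e \<in> (\<lambda>w. {v, w}) ` neighbours V E v"
      by (cases "v = x") (auto simp: neighbours_def insert_commute)
  qed (auto simp: neighbours_def)
  moreover have "inj_on (\<lambda>w. {v, w}) (neighbours V E v)"
    by (auto simp: inj_on_def doubleton_eq_iff)
  ultimately show ?thesis by (simp add: degree_def card_image)
qed

lemma min_degree_le_card_neighbours:
  assumes "simple_graph V E" "v \<in> V"
  shows "min_degree V E \<le> card (neighbours V E v)"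
  using assms unfolding degree_eq_card_neighbours[OF assms, symmetric] min_degree_def
  by (intro Min_le) (auto simp: simple_graph_def)

definition clique_tiling :: "nat \<Rightarrow> 'b set set \<Rightarrow> 'b set \<Rightarrow> bool" where
  "clique_tiling f E V \<longleftrightarrow> (\<exists>P. partition_on V P \<and> (\<forall>K\<in>P. card K = f \<and> nsets K 2 \<subseteq> E))"

lemma clique_tiling_UN:
  assumes "\<And>i. i \<in> I \<Longrightarrow> clique_tiling f E (A i)" "disjoint_family_on A I"
  shows "clique_tiling f E (\<Union>i\<in>I. A i)"
proof -
  obtain P where P: "\<And>i. i \<in> I \<Longrightarrow> partition_on (A i) (P i)"
    "\<And>i K. i \<in> I \<Longrightarrow> K \<in> P i \<Longrightarrow> card K = f \<and> nsets K 2 \<subseteq> E"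
    using assms(1) unfolding clique_tiling_def by metis
  have "partition_on (\<Union>i\<in>I. A i) (\<Union>i\<in>I. P i)"
  proof (rule partition_onI)
    fix K L assume "K \<in> (\<Union>i\<in>I. P i)" "L \<in> (\<Union>i\<in>I. P i)" "K \<noteq> L"
    then obtain i j where ij: "i \<in> I" "K \<in> P i" "j \<in> I" "L \<in> P j" by blast
    show "disjnt K L"
    proof (cases "i = j")
      case True
      then show ?thesis
        using ij \<open>K \<noteq> L\<close> partition_onD2[OF P(1)] by (simp add: pairwise_def)
    next
      case False
      then have "A i \<inter> A j = {}" using assms(2) ij by (simp add: disjoint_family_on_def)
      then show ?thesis
        using ij partition_onD1[OF P(1)] by (auto simp: disjnt_def)
    qed
  next
    show "\<Union>(\<Union>i\<in>I. P i) = (\<Union>i\<in>I. A i)"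
      using partition_onD1[OF P(1)] by auto
  qed (use partition_onD3[OF P(1)] in blast)
  then show ?thesis using P(2) unfolding clique_tiling_def by blast
qed

lemma clique_tiling_Un:
  assumes "clique_tiling f E V" "clique_tiling f E W" "V \<inter> W = {}"
  shows "clique_tiling f E (V \<union> W)"
proof -
  have "clique_tiling f E (\<Union>b. if b then V else W)"
    using assms by (intro clique_tiling_UN) (auto simp: disjoint_family_on_def)
  also have "(\<Union>b. if b then V else W) = V \<union> W" by (auto split: if_splits)
  finally show ?thesis .
qed

lemma clique_tiling_clique:
  assumes "finite A" "0 < f" "f dvd card A" "nsets A 2 \<subseteq> E"
  shows "clique_tiling f E A"
proof -
  obtain P where P: "partition_on A P" "\<And>K. K \<in> P \<Longrightarrow> card K = f"
    using partition_on_equal_cards[OF assms(1-3)] by blast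
  have "nsets K 2 \<subseteq> E" if "K \<in> P" for K
    using nsets_mono[of K A 2] partition_onD1[OF P(1)] that assms(4) by blast
  then show ?thesis using P unfolding clique_tiling_def by blast
qed

lemma nsets_insert_2_subset:
  assumes "nsets S 2 \<subseteq> E" "S \<subseteq> neighbours V E v"
  shows "nsets (insert v S) 2 \<subseteq> E"
  using assms by (auto simp: nsets_2_eq neighbours_def insert_commute)

lemma clique_tiling_stars:
  assumes "0 < f" "A \<inter> W = {}" "nsets W 2 \<subseteq> E"
    and leaves: "\<And>v. v \<in> A \<Longrightarrow> S v \<subseteq> neighbours W E v" "\<And>v. v \<in> A \<Longrightarrow> card (S v) = f - 1"
      "\<And>v. v \<in> A \<Longrightarrow> finite (S v)" "disjoint_family_on S A"
  shows "clique_tiling f E (A \<union> (\<Union>v\<in>A. S v))"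
proof -
  have S_W: "S v \<subseteq> W" if "v \<in> A" for v using leaves(1)[OF that] by (auto simp: neighbours_def)
  have "clique_tiling f E (\<Union>v\<in>A. insert v (S v))"
  proof (rule clique_tiling_UN)
    fix v assume v: "v \<in> A"
    show "clique_tiling f E (insert v (S v))"
    proof (rule clique_tiling_clique)
      have "v \<notin> S v" using S_W[OF v] v assms(2) by blast
      then show "f dvd card (insert v (S v))" using leaves(2,3)[OF v] \<open>0 < f\<close> by simp
      have "nsets (S v) 2 \<subseteq> E" using nsets_mono[OF S_W[OF v]] assms(3) by blast
      then show "nsets (insert v (S v)) 2 \<subseteq> E"
        using leaves(1)[OF v] by (rule nsets_insert_2_subset)
    qed (use leaves(3)[OF v] \<open>0 < f\<close> in auto)
  next
    show "disjoint_family_on (\<lambda>v. insert v (S v)) A"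
      unfolding disjoint_family_on_def
    proof (intro ballI impI)
      fix v w assume vw: "v \<in> A" "w \<in> A" "v \<noteq> w"
      then have "S v \<inter> S w = {}" using leaves(4) by (simp add: disjoint_family_on_def)
      then show "insert v (S v) \<inter> insert w (S w) = {}"
        using vw S_W[OF vw(1)] S_W[OF vw(2)] assms(2) by blast
    qed
  qed
  moreover have "(\<Union>v\<in>A. insert v (S v)) = A \<union> (\<Union>v\<in>A. S v)" by auto
  ultimately show ?thesis by simp
qed

text \<open>Each \<open>v \<in> A\<close> is put in a clique with its own \<open>f - 1\<close> neighbours in \<open>W\<close>; this lowers the number
  of uncovered vertices by \<open>f \<cdot> |A|\<close>, so that the rest of the clique \<open>W\<close> can still be tiled.\<close>

lemma clique_tiling_Un_clique:
  assumes "0 < f" "finite A" "finite W" "A \<inter> W = {}" "f dvd card (A \<union> W)" "nsets W 2 \<subseteq> E"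
    and many_neighbours: "\<And>v. v \<in> A \<Longrightarrow> card A * (f - 1) \<le> card (neighbours W E v)"
  shows "clique_tiling f E (A \<union> W)"
proof -
  obtain S where S: "\<And>v. v \<in> A \<Longrightarrow> S v \<subseteq> neighbours W E v" "\<And>v. v \<in> A \<Longrightarrow> card (S v) = f - 1"
    "\<And>v. v \<in> A \<Longrightarrow> finite (S v)" "disjoint_family_on S A"
    using disjoint_subsets_of_card[where A = "neighbours W E", OF \<open>finite A\<close> many_neighbours]
    by blast
  define T where "T = (\<Union>v\<in>A. S v)"
  have T: "T \<subseteq> W" "finite T"
    using S(1,3) \<open>finite A\<close> by (auto simp: T_def neighbours_def)
  have card_T: "card T = card A * (f - 1)"
    using S \<open>finite A\<close> unfolding T_def by (simp add: card_UN_disjoint')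
  have "clique_tiling f E (A \<union> T)"
    unfolding T_def using assms(1,4,6) S by (rule clique_tiling_stars)
  moreover have "clique_tiling f E (W - T)"
  proof (rule clique_tiling_clique)
    have "card W = card (W - T) + card T"
      using T \<open>finite W\<close> by (simp add: card_Diff_subset card_mono)
    moreover have "card A * (f - 1) + card A = f * card A"
      using \<open>0 < f\<close> by (cases f) simp_all
    ultimately have "card (A \<union> W) = card (W - T) + f * card A"
      using card_T assms(2-4) by (simp add: card_Un_disjoint)
    then show "f dvd card (W - T)" using assms(5) by (simp add: dvd_add_left_iff)
    show "nsets (W - T) 2 \<subseteq> E" using nsets_mono[of "W - T" W 2] assms(6) by blast
  qed (use assms in auto)
  moreover have "(A \<union> T) \<inter> (W - T) = {}" "(A \<union> T) \<union> (W - T) = A \<union> W"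
    using T(1) assms(4) by auto
  ultimately show ?thesis using clique_tiling_Un[of f E "A \<union> T" "W - T"] by simp
qed

lemma leftovers_exist:
  assumes "0 < f" "finite V" "f dvd card V" "finite B" "box_of ` V \<subseteq> B"
  obtains U where "U \<subseteq> V" "\<And>b. f dvd card {v \<in> V - U. box_of v = b}"
    "\<And>b. card {v \<in> U. box_of v = b} < f" "f dvd card U" "card U \<le> f * card B"
proof -
  have "\<exists>L. L \<subseteq> {v \<in> V. box_of v = b} \<and> card L = card {v \<in> V. box_of v = b} mod f" for b
    by (meson obtain_subset_with_card_n mod_less_eq_dividend)
  then obtain L where L: "\<And>b. L b \<subseteq> {v \<in> V. box_of v = b}"
    "\<And>b. card (L b) = card {v \<in> V. box_of v = b} mod f" by metis
  define U where "U = {v \<in> V. v \<in> L (box_of v)}"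
  have "U \<subseteq> V" by (auto simp: U_def)
  then have "finite U" using \<open>finite V\<close> by (rule finite_subset)
  have "{v \<in> U. box_of v = b} = L b" for b
    using L(1)[of b] by (auto simp: U_def)
  then have few: "card {v \<in> U. box_of v = b} < f" for b
    using L(2) \<open>0 < f\<close> by simp
  have "{v \<in> V - U. box_of v = b} = {v \<in> V. box_of v = b} - L b" for b
    using L(1)[of b] by (auto simp: U_def)
  moreover have "finite (L b)" for b
    using L(1)[of b] \<open>finite V\<close> by (auto intro: finite_subset)
  ultimately have "card {v \<in> V - U. box_of v = b}
      = card {v \<in> V. box_of v = b} - card {v \<in> V. box_of v = b} mod f" for b
    using L by (simp add: card_Diff_subset)
  then have dvd: "f dvd card {v \<in> V - U. box_of v = b}" for b
    by (simp add: minus_mod_eq_mult_div)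
  have "card (V - U) = (\<Sum>b\<in>B. card {v \<in> V - U. box_of v = b})"
    using assms(2,4,5) by (intro card_eq_sum_fibres) auto
  then have "f dvd card (V - U)" using dvd by (simp add: dvd_sum)
  moreover have "card V = card U + card (V - U)"
    using \<open>U \<subseteq> V\<close> \<open>finite V\<close> \<open>finite U\<close> by (simp add: card_Diff_subset card_mono)
  ultimately have "f dvd card U" using \<open>f dvd card V\<close> by (simp add: dvd_add_left_iff)
  have "card U = (\<Sum>b\<in>B. card {v \<in> U. box_of v = b})"
    using \<open>U \<subseteq> V\<close> \<open>finite U\<close> assms(4,5) by (intro card_eq_sum_fibres) auto
  also have "\<dots> \<le> (\<Sum>b\<in>B. f)" using few by (intro sum_mono less_imp_le)
  finally have "card U \<le> f * card B" by (simp add: mult.commute)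
  with \<open>U \<subseteq> V\<close> dvd few \<open>f dvd card U\<close> show ?thesis by (rule that)
qed

lemma card_le_double_card_Diff_UN:
  assumes "finite B" "finite I" and bad: "\<And>v. v \<in> I \<Longrightarrow> bad v \<subseteq> B"
    "\<And>v. v \<in> I \<Longrightarrow> 2 * card I * card (bad v) \<le> card B"
  shows "card B \<le> 2 * card (B - (\<Union>v\<in>I. bad v))"
proof (cases "I = {}")
  case False
  have "2 * card I * card (\<Union>v\<in>I. bad v) \<le> 2 * card I * (\<Sum>v\<in>I. card (bad v))"
    using card_UN_le[OF \<open>finite I\<close>, of bad] by simp
  also have "\<dots> \<le> (\<Sum>v\<in>I. card B)"
    unfolding sum_distrib_left using bad(2) by (intro sum_mono) auto
  finally have "2 * card (\<Union>v\<in>I. bad v) \<le> card B"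
    using False \<open>finite I\<close> by (simp add: card_gt_0_iff)
  moreover have "card (B - (\<Union>v\<in>I. bad v)) = card B - card (\<Union>v\<in>I. bad v)"
  proof (rule card_Diff_subset)
    show "(\<Union>v\<in>I. bad v) \<subseteq> B" using bad(1) by blast
    then show "finite (\<Union>v\<in>I. bad v)" using \<open>finite B\<close> by (rule finite_subset)
  qed
  ultimately show ?thesis by linarith
qed simp

text \<open>The elements of \<open>U\<close> are assigned in groups of \<open>f\<close>; the members of a group exclude at most half
  of \<open>B\<close> together, which leaves enough room for all groups.\<close>

lemma group_assignment_exists:
  assumes "0 < f" "finite U" "finite B" "f dvd card U" "card U \<le> f * card B"
    and bad: "\<And>v. v \<in> U \<Longrightarrow> bad v \<subseteq> B" "\<And>v. v \<in> U \<Longrightarrow> 2 * f * card (bad v) \<le> card B"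
  obtains a where "\<And>v. v \<in> U \<Longrightarrow> a v \<in> B - bad v" "\<And>b. f dvd card {v \<in> U. a v = b}"
    "\<And>b. card {v \<in> U. a v = b} \<le> 2 * f"
proof -
  obtain P where P: "partition_on U P" "\<And>I. I \<in> P \<Longrightarrow> card I = f"
    using partition_on_equal_cards[OF assms(2,1,4)] by blast
  have "finite P" using \<open>finite U\<close> P(1) by (rule finite_elements)
  have "card U = f * card P"
    using card_Union_partition[OF \<open>finite U\<close> P order_refl] partition_onD1[OF P(1)] by simp
  then have "card P \<le> card B" using assms(1,5) by simp
  have room: "card P \<le> 2 * card (B - (\<Union>v\<in>I. bad v))" if "I \<in> P" for I
  proof -
    have "I \<subseteq> U" using that partition_onD1[OF P(1)] by blast
    then have "card B \<le> 2 * card (B - (\<Union>v\<in>I. bad v))"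
      using P(2)[OF that] bad \<open>finite U\<close> \<open>finite B\<close>
      by (intro card_le_double_card_Diff_UN) (auto intro: finite_subset)
    then show ?thesis using \<open>card P \<le> card B\<close> by linarith
  qed
  obtain a where a_good: "\<And>I. I \<in> P \<Longrightarrow> a I \<in> B - (\<Union>v\<in>I. bad v)"
    and a_fibre: "\<And>b. card {I \<in> P. a I = b} \<le> 2"
    using bounded_multiplicity_choice[where good = "\<lambda>I. B - (\<Union>v\<in>I. bad v)", OF \<open>finite P\<close> room]
    by blast
  obtain group where group: "\<And>v. v \<in> U \<Longrightarrow> group v \<in> P \<and> v \<in> group v"
    "\<And>v I. I \<in> P \<Longrightarrow> v \<in> I \<Longrightarrow> group v = I"
    using partition_on_obtain_part[OF P(1)] by blast
  have "{v \<in> U. a (group v) = b} = \<Union>{I \<in> P. a I = b}" for b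
    using group partition_onD1[OF P(1)] by auto
  then have fibre: "card {v \<in> U. a (group v) = b} = f * card {I \<in> P. a I = b}" for b
    using card_Union_partition[OF \<open>finite U\<close> P, of "{I \<in> P. a I = b}"] by simp
  show ?thesis
  proof
    show "a (group v) \<in> B - bad v" if "v \<in> U" for v
      using group(1)[OF that] a_good[of "group v"] by blast
    show "f dvd card {v \<in> U. a (group v) = b}" "card {v \<in> U. a (group v) = b} \<le> 2 * f" for b
      unfolding fibre using a_fibre[of b] by simp_all
  qed
qed

lemma clique_tiling_of_boxes:
  assumes "0 < f" "finite B" "finite V" "f dvd card V" and box_of: "box_of ` V \<subseteq> B"
    and same_box: "\<And>v w. v \<in> V \<Longrightarrow> w \<in> V \<Longrightarrow> box_of v = box_of w \<Longrightarrow> v \<noteq> w \<Longrightarrow> {v, w} \<in> E"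
    and few_poor: "\<And>v. v \<in> V \<Longrightarrow>
      2 * f * card {b \<in> B. card (neighbours {w \<in> V. box_of w = b} E v) < 2 * f\<^sup>2} \<le> card B"
  shows "clique_tiling f E V"
proof -
  define poor where "poor = (\<lambda>v. {b \<in> B. card (neighbours {w \<in> V. box_of w = b} E v) < 2 * f\<^sup>2})"
  obtain U where U: "U \<subseteq> V" "\<And>b. f dvd card {v \<in> V - U. box_of v = b}"
    "\<And>b. card {v \<in> U. box_of v = b} < f" "f dvd card U" "card U \<le> f * card B"
    using leftovers_exist[OF assms(1,3,4,2,5)] by blast
  have "finite U" using U(1) \<open>finite V\<close> by (rule finite_subset)
  obtain a where a_rich: "\<And>v. v \<in> U \<Longrightarrow> a v \<in> B - poor v"
    and a_dvd: "\<And>b. f dvd card {v \<in> U. a v = b}" and a_le: "\<And>b. card {v \<in> U. a v = b} \<le> 2 * f"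
    by (rule group_assignment_exists[OF \<open>0 < f\<close> \<open>finite U\<close> \<open>finite B\<close> U(4,5), where bad = poor])
      (use few_poor U(1) in \<open>auto simp: poor_def\<close>)
  have "clique_tiling f E (\<Union>b\<in>B. {v \<in> U. a v = b} \<union> {w \<in> V - U. box_of w = b})"
  proof (rule clique_tiling_UN, rule clique_tiling_Un_clique)
    fix b v assume v_assigned: "v \<in> {v \<in> U. a v = b}"
    let ?N = "neighbours {w \<in> V. box_of w = b} E v" and ?L = "{w \<in> U. box_of w = b}"
    have "card {v \<in> U. a v = b} * (f - 1) \<le> 2 * f * (f - 1)" by (intro mult_right_mono a_le) simp
    also have "\<dots> \<le> 2 * f\<^sup>2 - f" by (simp add: power2_eq_square diff_mult_distrib2)
    also have "\<dots> \<le> card ?N - card ?L"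
      using a_rich[of v] v_assigned U(3)[of b] by (auto simp: poor_def)
    also have "\<dots> \<le> card (?N - ?L)" using \<open>finite U\<close> by (intro diff_card_le_card_Diff) simp
    also have "?N - ?L = neighbours {w \<in> V - U. box_of w = b} E v" by (auto simp: neighbours_def)
    finally show "card {v \<in> U. a v = b} * (f - 1)
        \<le> card (neighbours {w \<in> V - U. box_of w = b} E v)" .
  next
    show "f dvd card ({v \<in> U. a v = b} \<union> {w \<in> V - U. box_of w = b})" for b
    proof -
      have "card ({v \<in> U. a v = b} \<union> {w \<in> V - U. box_of w = b})
          = card {v \<in> U. a v = b} + card {w \<in> V - U. box_of w = b}"
        using \<open>finite U\<close> \<open>finite V\<close> by (intro card_Un_disjoint) auto
      then show ?thesis using a_dvd U(2) by simp
    qed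
    show "nsets {w \<in> V - U. box_of w = b} 2 \<subseteq> E" for b
      using same_box by (auto elim!: nsets2_E)
  qed (use \<open>0 < f\<close> \<open>finite U\<close> \<open>finite V\<close> in \<open>auto simp: disjoint_family_on_def\<close>)
  moreover have "(\<Union>b\<in>B. {v \<in> U. a v = b} \<union> {w \<in> V - U. box_of w = b}) = V"
  proof (intro equalityI subsetI)
    fix v assume "v \<in> V"
    then show "v \<in> (\<Union>b\<in>B. {v \<in> U. a v = b} \<union> {w \<in> V - U. box_of w = b})"
      using a_rich[of v] box_of by (cases "v \<in> U") auto
  qed (use U(1) in auto)
  ultimately show ?thesis by simp
qed

lemma isomorphic_copy_in_clique:
  assumes "simple_graph VF EF" "VF \<noteq> {}" "card K = card VF" "nsets K 2 \<subseteq> E"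
  shows "\<exists>D\<subseteq>E. isomorphic_copy VF EF K D"
proof -
  have "finite VF" "EF \<subseteq> nsets VF 2" using assms(1) by (auto simp: simple_graph_def)
  moreover from this have "finite K"
    using assms(2,3) by (auto intro: card_ge_0_finite simp: card_gt_0_iff)
  ultimately obtain \<phi> where \<phi>: "bij_betw \<phi> VF K"
    using assms(3) by (metis finite_same_card_bij)
  then have "(\<lambda>e. \<phi> ` e) ` EF \<subseteq> nsets K 2"
    using bij_betw_nsets[OF \<phi>, of 2] \<open>EF \<subseteq> nsets VF 2\<close> by (auto simp: bij_betw_def)
  then show ?thesis
    using \<phi> assms(4) by (intro exI[of _ "(\<lambda>e. \<phi> ` e) ` EF"]) (auto simp: isomorphic_copy_def)
qed

lemma has_factor_if_clique_tiling:
  assumes "simple_graph VF EF" "VF \<noteq> {}" "clique_tiling (card VF) E V"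
  shows "has_factor VF EF V E"
proof -
  obtain P where P: "partition_on V P" "\<forall>K\<in>P. card K = card VF \<and> nsets K 2 \<subseteq> E"
    using assms(3) unfolding clique_tiling_def by blast
  have "\<exists>D\<subseteq>E. isomorphic_copy VF EF K D" if "K \<in> P" for K
    using P(2) that by (intro isomorphic_copy_in_clique[OF assms(1,2)]) auto
  then obtain D where D: "\<And>K. K \<in> P \<Longrightarrow> D K \<subseteq> E \<and> isomorphic_copy VF EF K (D K)" by metis
  have "disjoint_family_on fst ((\<lambda>K. (K, D K)) ` P)"
    using partition_onD2[OF P(1)] by (auto simp: disjoint_family_on_def pairwise_def disjnt_def)
  then show ?thesis
    unfolding has_factor_def using D partition_onD1[OF P(1)]
    by (intro exI[of _ "(\<lambda>K. (K, D K)) ` P"]) auto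
qed

section \<open>Counting points of a product measure\<close>

lemma power_card_eq_prod:
  fixes z :: real
  assumes "finite I" "J \<subseteq> I"
  shows "z ^ card {j \<in> J. x j \<in> T j}
    = (\<Prod>i\<in>I. if i \<in> J then 1 + (z - 1) * indicator (T i) (x i) else 1)"
proof -
  have "finite J" using assms by (rule finite_subset[rotated])
  have "z ^ card {j \<in> J. x j \<in> T j} = (\<Prod>j\<in>J. if x j \<in> T j then z else 1)"
    using \<open>finite J\<close> by (simp flip: prod.inter_filter)
  also have "\<dots> = (\<Prod>j\<in>J. 1 + (z - 1) * indicator (T j) (x j))"
    by (intro prod.cong) auto
  also have "\<dots> = (\<Prod>i\<in>I. if i \<in> J then 1 + (z - 1) * indicator (T i) (x i) else 1)"
    using assms by (intro prod.mono_neutral_cong_left) auto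
  finally show ?thesis .
qed

lemma (in product_prob_space)
  fixes z :: real
  assumes "finite I" "J \<subseteq> I" and T: "\<And>j. j \<in> J \<Longrightarrow> T j \<in> sets (M j)"
  shows integrable_power_card: "integrable (PiM I M) (\<lambda>x. z ^ card {j \<in> J. x j \<in> T j})"
    and integral_power_card: "(\<integral>x. z ^ card {j \<in> J. x j \<in> T j} \<partial>PiM I M)
      = (\<Prod>j\<in>J. 1 + (z - 1) * measure (M j) (T j))"
proof -
  define g where "g = (\<lambda>i y. if i \<in> J then 1 + (z - 1) * indicator (T i) y else (1 :: real))"
  have g_integrable: "integrable (M i) (g i)"
    and g_integral: "integral\<^sup>L (M i) (g i)
      = (if i \<in> J then 1 + (z - 1) * measure (M i) (T i) else 1)"
    for i
    unfolding g_def using T[of i] by (cases "i \<in> J"; simp add: less_top[symmetric] M.prob_space)+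
  have prod_eq: "z ^ card {j \<in> J. x j \<in> T j} = (\<Prod>i\<in>I. g i (x i))" for x
    unfolding g_def using assms(1,2) by (rule power_card_eq_prod)
  show "integrable (PiM I M) (\<lambda>x. z ^ card {j \<in> J. x j \<in> T j})"
    unfolding prod_eq using \<open>finite I\<close> g_integrable by (rule product_integrable_prod)
  have "(\<integral>x. z ^ card {j \<in> J. x j \<in> T j} \<partial>PiM I M) = (\<Prod>i\<in>I. integral\<^sup>L (M i) (g i))"
    unfolding prod_eq using \<open>finite I\<close> g_integrable by (rule product_integral_prod)
  also have "\<dots> = (\<Prod>j\<in>J. 1 + (z - 1) * measure (M j) (T j))"
    unfolding g_integral using assms(1,2) by (intro prod.mono_neutral_cong_right) auto
  finally show "(\<integral>x. z ^ card {j \<in> J. x j \<in> T j} \<partial>PiM I M) = \<dots>" .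
qed

lemma (in product_prob_space) prob_few_points_le:
  assumes "finite I" "J \<subseteq> I" and T: "\<And>j. j \<in> J \<Longrightarrow> T j \<in> sets (M j)"
    and p_le: "\<And>j. j \<in> J \<Longrightarrow> p \<le> measure (M j) (T j)"
  shows "\<P>(x in PiM I M. card {j \<in> J. x j \<in> T j} \<le> a) \<le> 2 ^ a * exp (- p * real (card J) / 2)"
proof -
  let ?X = "\<lambda>x. (1 / 2 :: real) ^ card {j \<in> J. x j \<in> T j}"
  have "\<P>(x in PiM I M. card {j \<in> J. x j \<in> T j} \<le> a) = \<P>(x in PiM I M. (1 / 2) ^ a \<le> ?X x)"
    by (simp add: power_decreasing_iff)
  also have "\<dots> \<le> (\<integral>x. ?X x \<partial>PiM I M) / (1 / 2) ^ a"
    using integrable_power_card[OF assms(1-3)] by (intro integral_Markov_inequality_measure) auto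
  also have "(\<integral>x. ?X x \<partial>PiM I M) = (\<Prod>j\<in>J. 1 - measure (M j) (T j) / 2)"
    using integral_power_card[OF assms(1-3)] by simp
  also have "\<dots> \<le> (\<Prod>j\<in>J. exp (- p / 2))"
  proof (intro prod_mono conjI)
    fix j assume "j \<in> J"
    show "0 \<le> 1 - measure (M j) (T j) / 2" using M.prob_le_1[of j "T j"] by linarith
    have "1 - measure (M j) (T j) / 2 \<le> 1 + (- p / 2)" using p_le[OF \<open>j \<in> J\<close>] by simp
    also have "\<dots> \<le> exp (- p / 2)" by (rule exp_ge_add_one_self)
    finally show "1 - measure (M j) (T j) / 2 \<le> exp (- p / 2)" .
  qed
  also have "\<dots> = exp (- p * real (card J) / 2)" by (simp flip: exp_of_nat_mult)
  finally show ?thesis by (simp add: power_one_over divide_right_mono mult.commute)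
qed

lemma (in product_prob_space) prob_pair_le:
  assumes "finite I" "i \<in> I" "j \<in> I" "i \<noteq> j"
    and Q: "{x \<in> space (PiM I M). Q (x i) (x j)} \<in> sets (PiM I M)"
    and section_sets: "\<And>y. y \<in> space (M i) \<Longrightarrow> {z \<in> space (M j). Q y z} \<in> sets (M j)"
    and section_le: "\<And>y. y \<in> space (M i) \<Longrightarrow> \<P>(z in M j. Q y z) \<le> c"
  shows "\<P>(x in PiM I M. Q (x i) (x j)) \<le> c"
proof -
  let ?A = "{x \<in> space (PiM I M). Q (x i) (x j)}" and ?J = "I - {j}"
  have insert_J: "insert j ?J = I" using assms by auto
  obtain y where "y \<in> space (M i)" using M.not_empty[of i] by auto
  then have "0 \<le> c" using section_le[of y] measure_nonneg order_trans by blast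
  have "emeasure (PiM I M) ?A = (\<integral>\<^sup>+x. indicator ?A x \<partial>PiM (insert j ?J) M)"
    unfolding insert_J using Q by simp
  also have "\<dots> = (\<integral>\<^sup>+x. (\<integral>\<^sup>+z. indicator ?A (x(j := z)) \<partial>M j) \<partial>PiM ?J M)"
    using Q \<open>finite I\<close>
    by (intro product_nn_integral_insert) (simp_all add: insert_J del: insert_Diff_single)
  also have "\<dots> \<le> (\<integral>\<^sup>+x. ennreal c \<partial>PiM ?J M)"
  proof (rule nn_integral_mono)
    fix x assume "x \<in> space (PiM ?J M)"
    then have x_i: "x i \<in> space (M i)" using assms(2,4) by (auto simp: space_PiM)
    have "(\<integral>\<^sup>+z. indicator ?A (x(j := z)) \<partial>M j)
        \<le> (\<integral>\<^sup>+z. indicator {z \<in> space (M j). Q (x i) z} z \<partial>M j)"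
      using \<open>i \<noteq> j\<close> by (intro nn_integral_mono) (auto simp: indicator_def)
    also have "\<dots> = ennreal (\<P>(z in M j. Q (x i) z))"
      using section_sets[OF x_i] by (simp add: M.emeasure_eq_measure)
    also have "\<dots> \<le> ennreal c" using section_le[OF x_i] by (rule ennreal_leI)
    finally show "(\<integral>\<^sup>+z. indicator ?A (x(j := z)) \<partial>M j) \<le> ennreal c" .
  qed
  also have "\<dots> = ennreal c"
    by (simp add: prob_space.emeasure_space_1[OF prob_space_PiM[OF prob_space]])
  finally show ?thesis using \<open>0 \<le> c\<close> by (simp add: P.emeasure_eq_measure)
qed

section \<open>Uniform points in the cube\<close>

abbreviation unit_cube :: "(real ^ 'd) measure" where
  "unit_cube \<equiv> uniform_measure lborel (cbox 0 1)"

lemma emeasure_lborel_unit_cube: "emeasure lborel (cbox 0 1 :: (real ^ 'd) set) = 1"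
proof -
  have "(1 :: real ^ 'd) \<bullet> b = 1" if "b \<in> Basis" for b
    using that by (auto simp: Basis_vec_def inner_axis)
  then show ?thesis by simp
qed

lemma prob_space_unit_cube: "prob_space unit_cube"
  by (rule prob_space_uniform_measure) (simp_all add: emeasure_lborel_unit_cube)

lemma product_prob_space_unit_cube: "product_prob_space (\<lambda>_. unit_cube)"
  by (intro product_prob_spaceI prob_space_unit_cube)

lemma measure_unit_cube:
  assumes "T \<in> sets borel"
  shows "measure (unit_cube :: (real ^ 'd) measure) T = measure lborel (cbox 0 1 \<inter> T)"
  using assms emeasure_lborel_unit_cube[where 'd = 'd]
  by (subst measure_uniform_measure) (auto simp: measure_def)

lemma measure_lborel_cball_le:
  fixes z :: "'a :: euclidean_space"
  assumes "0 \<le> r"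
  shows "measure lborel (cball z r) \<le> (2 * r) ^ DIM('a)"
proof -
  let ?l = "z - r *\<^sub>R One"
  have "cball z r \<subseteq> cbox ?l (?l + (2 * r) *\<^sub>R One)"
  proof
    fix y assume "y \<in> cball z r"
    then have "\<bar>(z - y) \<bullet> b\<bar> \<le> r" if "b \<in> Basis" for b
      using Basis_le_norm[OF that, of "z - y"] by (simp add: dist_norm)
    then show "y \<in> cbox ?l (?l + (2 * r) *\<^sub>R One)"
      by (force simp: mem_box inner_diff_left inner_add_left abs_le_iff)
  qed
  then have "measure lborel (cball z r) \<le> measure lborel (cbox ?l (?l + (2 * r) *\<^sub>R One))"
    by (intro measure_mono_fmeasurable) (auto intro: fmeasurable_compact)
  also have "\<dots> = (2 * r) ^ DIM('a)" using assms by (simp only: content_cbox_plus) simp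
  finally show ?thesis .
qed

lemma measure_unit_cube_cball_le:
  fixes z :: "real ^ 'd"
  assumes "0 \<le> r"
  shows "measure unit_cube (cball z r) \<le> (2 * r) ^ CARD('d)"
proof -
  have "measure unit_cube (cball z r) \<le> measure lborel (cball z r)"
    unfolding measure_unit_cube[OF borel_closed[OF closed_cball]]
    by (intro measure_mono_fmeasurable) (auto intro: fmeasurable_compact)
  then show ?thesis using measure_lborel_cball_le[OF assms, of z] by simp
qed

lemma prob_space_uniform_points: "prob_space (uniform_points n :: (nat \<Rightarrow> real ^ 'd) measure)"
  unfolding uniform_points_def by (intro prob_space_PiM prob_space_unit_cube)

lemma measurable_uniform_points_component [measurable]:
  assumes "i \<in> {1..n}"
  shows "(\<lambda>x. x i) \<in> (uniform_points n :: (nat \<Rightarrow> real ^ 'd) measure) \<rightarrow>\<^sub>M borel"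
proof -
  have "(\<lambda>x. x i) \<in> (uniform_points n :: (nat \<Rightarrow> real ^ 'd) measure) \<rightarrow>\<^sub>M unit_cube"
    unfolding uniform_points_def using assms by (rule measurable_component_singleton)
  then show ?thesis by (simp cong: measurable_cong_sets)
qed

lemma AE_uniform_points_in_cube:
  "AE x in (uniform_points n :: (nat \<Rightarrow> real ^ 'd) measure). \<forall>i\<in>{1..n}. x i \<in> cbox 0 1"
  unfolding uniform_points_def
  by (intro eventually_ball_finite ballI AE_PiM_component prob_space_unit_cube AE_uniform_measureI)
    auto

lemma doubleton_in_geometric_edges:
  assumes "i \<in> {1..n}" "j \<in> {1..n}" "i \<noteq> j"
  shows "{i, j} \<in> geometric_edges n r x \<longleftrightarrow> norm (x i - x j) \<le> r"
  using assms by (auto simp: geometric_edges_def doubleton_eq_iff norm_minus_commute)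

lemma geometric_edges_subset: "geometric_edges n r x \<subseteq> nsets {1..n} 2"
  by (auto simp: geometric_edges_def)

lemma finite_geometric_edges: "finite (geometric_edges n r x)"
  by (rule finite_subset[OF geometric_edges_subset]) (simp add: finite_imp_finite_nsets)

lemma pred_in_geometric_edges:
  assumes "e \<in> nsets {1..n} 2"
  shows "Measurable.pred (uniform_points n :: (nat \<Rightarrow> real ^ 'd) measure)
    (\<lambda>x. e \<in> geometric_edges n r x)"
proof -
  obtain i j where ij: "e = {i, j}" "i \<in> {1..n}" "j \<in> {1..n}" "i \<noteq> j"
    using assms by (rule nsets2_E)
  have "e \<in> geometric_edges n r x \<longleftrightarrow> norm (x i - x j) \<le> r" for x :: "nat \<Rightarrow> real ^ 'd"
    unfolding ij(1) using ij(2-4) by (rule doubleton_in_geometric_edges)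
  moreover note [measurable] = ij(2,3)
  ultimately show ?thesis by simp
qed

lemma sets_geometric_edges_event:
  "{x \<in> space (uniform_points n :: (nat \<Rightarrow> real ^ 'd) measure). Q (geometric_edges n r x)}
    \<in> sets (uniform_points n)"
proof -
  let ?N = "nsets {1..n} 2"
  have "finite ?N" by (simp add: finite_imp_finite_nsets)
  have "Q (geometric_edges n r x)
      \<longleftrightarrow> (\<exists>G\<in>{G \<in> Pow ?N. Q G}. \<forall>e\<in>?N. e \<in> geometric_edges n r x \<longleftrightarrow> e \<in> G)"
    for x :: "nat \<Rightarrow> real ^ 'd"
  proof
    assume "\<exists>G\<in>{G \<in> Pow ?N. Q G}. \<forall>e\<in>?N. e \<in> geometric_edges n r x \<longleftrightarrow> e \<in> G"
    then obtain G where "G \<subseteq> ?N" "Q G" "\<forall>e\<in>?N. e \<in> geometric_edges n r x \<longleftrightarrow> e \<in> G" by blast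
    moreover from this have "geometric_edges n r x = G" using geometric_edges_subset by blast
    ultimately show "Q (geometric_edges n r x)" by simp
  qed (use geometric_edges_subset in blast)
  moreover have "Measurable.pred (uniform_points n :: (nat \<Rightarrow> real ^ 'd) measure)
      (\<lambda>x. \<exists>G\<in>{G \<in> Pow ?N. Q G}. \<forall>e\<in>?N. e \<in> geometric_edges n r x \<longleftrightarrow> e \<in> G)"
    using \<open>finite ?N\<close> pred_in_geometric_edges by (intro pred_intros_finite pred_intros_logic) auto
  ultimately show ?thesis by (simp add: pred_def)
qed

lemma prob_close_le:
  assumes "i \<in> {1..n}" "j \<in> {1..n}" "i \<noteq> j" "0 \<le> r"
  shows "\<P>(x in (uniform_points n :: (nat \<Rightarrow> real ^ 'd) measure). norm (x i - x j) \<le> r)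
    \<le> (2 * r) ^ CARD('d)"
proof -
  have sets: "{x \<in> space (uniform_points n :: (nat \<Rightarrow> real ^ 'd) measure). norm (x i - x j) \<le> r}
      \<in> sets (uniform_points n)"
    using assms(1,2) by measurable
  have ball: "{y \<in> space unit_cube. norm (z - y) \<le> r} = cball z r" for z :: "real ^ 'd"
    by (auto simp: dist_norm)
  show ?thesis
    unfolding uniform_points_def
  proof (rule product_prob_space.prob_pair_le[OF product_prob_space_unit_cube _ assms(1-3)])
    show "\<P>(y in unit_cube. norm (z - y) \<le> r) \<le> (2 * r) ^ CARD('d)" for z :: "real ^ 'd"
      unfolding ball using \<open>0 \<le> r\<close> by (rule measure_unit_cube_cball_le)
    show "{y \<in> space unit_cube. norm (z - y) \<le> r} \<in> sets unit_cube" for z :: "real ^ 'd"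
      unfolding ball by simp
  qed (use sets in \<open>simp_all add: uniform_points_def\<close>)
qed

lemma prob_many_edges_le:
  assumes "0 < t" "0 \<le> r"
  shows "\<P>(x in (uniform_points n :: (nat \<Rightarrow> real ^ 'd) measure).
      t \<le> real (card (geometric_edges n r x)))
    \<le> real (n choose 2) * (2 * r) ^ CARD('d) / t"
proof -
  interpret prob_space "uniform_points n :: (nat \<Rightarrow> real ^ 'd) measure"
    by (rule prob_space_uniform_points)
  let ?U = "uniform_points n :: (nat \<Rightarrow> real ^ 'd) measure" and ?N = "nsets {1..n} 2"
  define A where "A = (\<lambda>e. {x \<in> space ?U. e \<in> geometric_edges n r x})"
  have card_eq: "real (card (geometric_edges n r x)) = (\<Sum>e\<in>?N. indicator (A e) x)"
    if "x \<in> space ?U" for x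
  proof -
    have "geometric_edges n r x = {e \<in> ?N. x \<in> A e}"
      using that geometric_edges_subset[of n r x] by (auto simp: A_def)
    then show ?thesis by (simp add: indicator_def Int_def finite_imp_finite_nsets)
  qed
  have A_sets: "A e \<in> sets ?U" for e unfolding A_def by (rule sets_geometric_edges_event)
  have integrable_sum: "integrable ?U (\<lambda>x. \<Sum>e\<in>?N. indicator (A e) x :: real)"
    using A_sets by (auto simp: less_top[symmetric])
  have "\<P>(x in ?U. t \<le> real (card (geometric_edges n r x)))
      = \<P>(x in ?U. t \<le> (\<Sum>e\<in>?N. indicator (A e) x))"
    by (intro arg_cong[where f = prob] Collect_cong) (simp add: card_eq cong: conj_cong)
  also have "\<dots> \<le> (\<integral>x. (\<Sum>e\<in>?N. indicator (A e) x) \<partial>?U) / t"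
    using integrable_sum \<open>0 < t\<close>
    by (intro integral_Markov_inequality_measure) (auto simp: sum_nonneg)
  also have "(\<integral>x. (\<Sum>e\<in>?N. indicator (A e) x) \<partial>?U) = (\<Sum>e\<in>?N. prob (A e))"
    using A_sets by (simp add: less_top[symmetric])
  also have "\<dots> \<le> (\<Sum>e\<in>?N. (2 * r) ^ CARD('d))"
  proof (rule sum_mono)
    fix e assume "e \<in> ?N"
    then obtain i j where "e = {i, j}" "i \<in> {1..n}" "j \<in> {1..n}" "i \<noteq> j" by (rule nsets2_E)
    then show "prob (A e) \<le> (2 * r) ^ CARD('d)"
      using prob_close_le[of i n j r, where 'd = 'd] \<open>0 \<le> r\<close>
      by (simp add: A_def doubleton_in_geometric_edges)
  qed
  finally show ?thesis using \<open>0 < t\<close> by (simp add: divide_right_mono)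
qed

section \<open>Cells of the cube\<close>

definition grid :: "nat \<Rightarrow> ('d::finite \<Rightarrow> nat) set" where
  "grid m = PiE UNIV (\<lambda>_. {..<m})"

definition cell_index :: "nat \<Rightarrow> real ^ 'd \<Rightarrow> 'd \<Rightarrow> nat" where
  "cell_index m x = (\<lambda>i. min (nat \<lfloor>real m * x $ i\<rfloor>) (m - 1))"

lemma finite_grid: "finite (grid m :: ('d::finite \<Rightarrow> nat) set)"
  unfolding grid_def by (intro finite_PiE) auto

lemma card_grid: "card (grid m :: ('d::finite \<Rightarrow> nat) set) = m ^ CARD('d)"
  by (simp add: grid_def card_PiE)

lemma finite_grid_subsets: "finite {S. S \<subseteq> (grid m :: ('d::finite \<Rightarrow> nat) set) \<and> Q S}"
  by (rule finite_subset[of _ "Pow (grid m)"]) (auto simp: finite_grid)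

lemma card_grid_subsets_le:
  "card {S. S \<subseteq> (grid m :: ('d::finite \<Rightarrow> nat) set) \<and> Q S} \<le> 2 ^ m ^ CARD('d)"
proof -
  have "card {S. S \<subseteq> (grid m :: ('d \<Rightarrow> nat) set) \<and> Q S} \<le> card (Pow (grid m :: ('d \<Rightarrow> nat) set))"
    by (intro card_mono) (auto simp: finite_grid)
  then show ?thesis by (simp add: card_Pow finite_grid card_grid)
qed

lemma cell_index_in_grid: "0 < m \<Longrightarrow> cell_index m x \<in> grid m"
  by (auto simp: grid_def cell_index_def)

lemma measurable_cell_index [measurable]:
  "(cell_index m :: real ^ 'd \<Rightarrow> _) \<in> borel \<rightarrow>\<^sub>M count_space UNIV"
proof -
  have "cell_index m -` {k} \<inter> space borel
      = {x :: real ^ 'd. \<forall>i. min (nat \<lfloor>real m * x $ i\<rfloor>) (m - 1) = k i}" for k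
    by (auto simp: cell_index_def)
  then show ?thesis by (simp add: measurable_count_space_eq2_countable)
qed

lemma cell_index_bounds:
  assumes "0 < m" "x \<in> cbox 0 1"
  shows "real (cell_index m x i) \<le> real m * x $ i" "real m * x $ i \<le> real (cell_index m x i) + 1"
proof -
  have "0 \<le> x $ i" "x $ i \<le> 1" using assms(2) by (auto simp: mem_box_cart)
  then have "0 \<le> real m * x $ i" "real m * x $ i \<le> real m"
    by (simp_all add: mult_left_le)
  then show "real (cell_index m x i) \<le> real m * x $ i"
    "real m * x $ i \<le> real (cell_index m x i) + 1"
    using assms(1) unfolding cell_index_def by linarith+
qed

lemma norm_le_if_same_cell:
  fixes x y :: "real ^ 'd"
  assumes "0 < m" "x \<in> cbox 0 1" "y \<in> cbox 0 1" "cell_index m x = cell_index m y"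
  shows "norm (x - y) \<le> real CARD('d) / real m"
proof -
  have "\<bar>(x - y) $ i\<bar> \<le> 1 / real m" for i
  proof -
    have "\<bar>real m * x $ i - real m * y $ i\<bar> \<le> 1"
      using cell_index_bounds[OF assms(1,2), of i] cell_index_bounds[OF assms(1,3), of i]
      unfolding assms(4) by linarith
    then have "real m * \<bar>x $ i - y $ i\<bar> \<le> 1"
      using assms(1) by (simp add: abs_mult flip: right_diff_distrib)
    then show ?thesis using assms(1) by (simp add: field_simps)
  qed
  then have "(\<Sum>i\<in>UNIV. \<bar>(x - y) $ i\<bar>) \<le> (\<Sum>i\<in>(UNIV :: 'd set). 1 / real m)"
    by (intro sum_mono)
  then show ?thesis using norm_le_l1_cart[of "x - y"] by simp
qed

lemma box_subset_cell:
  fixes k :: "'d::finite \<Rightarrow> nat"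
  assumes "0 < m" "k \<in> grid m"
  shows "box (\<chi> i. real (k i) / real m) (\<chi> i. (real (k i) + 1) / real m)
    \<subseteq> cbox 0 1 \<inter> {x. cell_index m x = k}"
proof
  fix x assume "x \<in> box (\<chi> i. real (k i) / real m) (\<chi> i. (real (k i) + 1) / real m)"
  then have x_bounds: "real (k i) < real m * x $ i" "real m * x $ i < real (k i) + 1" for i
    using assms(1) by (auto simp: mem_box_cart field_simps)
  have k_less: "k i < m" for i using assms(2) by (auto simp: grid_def)
  have "\<lfloor>real m * x $ i\<rfloor> = int (k i)" for i using x_bounds[of i] by linarith
  moreover have "k i \<le> m - 1" for i using k_less[of i] by simp
  ultimately have "cell_index m x = k" by (simp add: cell_index_def fun_eq_iff)
  moreover have "0 \<le> x $ i \<and> x $ i \<le> 1" for i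
  proof -
    have "0 < real m * x $ i" "real m * x $ i < real m * 1"
      using x_bounds[of i] k_less[of i] by linarith+
    then show ?thesis using assms(1) by (simp add: zero_less_mult_iff)
  qed
  ultimately show "x \<in> cbox 0 1 \<inter> {x. cell_index m x = k}"
    by (simp add: mem_box_cart)
qed

lemma measure_cell_ge:
  fixes k :: "'d::finite \<Rightarrow> nat"
  assumes "0 < m" "k \<in> grid m"
  shows "(1 / real m) ^ CARD('d) \<le> measure unit_cube {x :: real ^ 'd. cell_index m x = k}"
proof -
  let ?l = "\<chi> i. real (k i) / real m" and ?u = "\<chi> i. (real (k i) + 1) / real m"
  have "cbox ?l ?u \<noteq> {}" by (simp add: interval_ne_empty_cart divide_right_mono)
  then have "(1 / real m) ^ CARD('d) = measure lborel (cbox ?l ?u)"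
    by (simp add: content_cbox_cart flip: diff_divide_distrib)
  also have "\<dots> = measure lborel (box ?l ?u)"
    by (simp only: measure_lborel_box_eq measure_lborel_cbox_eq)
  also have "\<dots> \<le> measure lborel (cbox 0 1 \<inter> {x :: real ^ 'd. cell_index m x = k})"
  proof (rule measure_mono_fmeasurable[OF box_subset_cell[OF assms]])
    have "{x :: real ^ 'd. cell_index m x = k} \<in> sets borel" by measurable
    then show "cbox 0 1 \<inter> {x :: real ^ 'd. cell_index m x = k} \<in> fmeasurable lborel"
      by (intro fmeasurable_Int_fmeasurable fmeasurable_cbox) simp
  qed simp
  also have "\<dots> = measure unit_cube {x :: real ^ 'd. cell_index m x = k}"
    by (intro measure_unit_cube[symmetric]) measurable
  finally show ?thesis .
qed

lemma measure_cells_ge: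
  fixes S :: "('d::finite \<Rightarrow> nat) set"
  assumes "0 < m" "S \<subseteq> grid m"
  shows "real (card S) / real (m ^ CARD('d))
    \<le> measure unit_cube {x :: real ^ 'd. cell_index m x \<in> S}"
proof -
  interpret prob_space "unit_cube :: (real ^ 'd) measure" by (rule prob_space_unit_cube)
  have "finite S" using assms(2) finite_grid by (rule finite_subset)
  have "real (card S) / real (m ^ CARD('d)) = (\<Sum>k\<in>S. (1 / real m) ^ CARD('d))"
    by (simp add: power_one_over)
  also have "\<dots> \<le> (\<Sum>k\<in>S. prob {x. cell_index m x = k})"
    using assms by (intro sum_mono measure_cell_ge) auto
  also have "\<dots> = prob (\<Union>k\<in>S. {x. cell_index m x = k})"
  proof (rule finite_measure_finite_Union[symmetric])
    have "{x :: real ^ 'd. cell_index m x = k} \<in> sets borel" for k by measurable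
    then show "(\<lambda>k. {x. cell_index m x = k}) ` S \<subseteq> events" by auto
  qed (auto simp: \<open>finite S\<close> disjoint_family_on_def)
  also have "(\<Union>k\<in>S. {x. cell_index m x = k}) = {x :: real ^ 'd. cell_index m x \<in> S}" by auto
  finally show ?thesis .
qed

definition few_points_event ::
  "nat \<Rightarrow> nat set \<Rightarrow> nat \<Rightarrow> ('d::finite \<Rightarrow> nat) set \<Rightarrow> nat \<Rightarrow> (nat \<Rightarrow> real ^ 'd) set" where
  "few_points_event n J m S a
    = {x \<in> space (uniform_points n). card {w \<in> J. cell_index m (x w) \<in> S} \<le> a}"

lemma sets_few_points_event:
  assumes "J \<subseteq> {1..n}"
  shows "few_points_event n J m (S :: ('d::finite \<Rightarrow> nat) set) a \<in> sets (uniform_points n)"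
proof -
  have [measurable]: "Measurable.pred (uniform_points n) (\<lambda>x. w \<in> J \<and> cell_index m (x w) \<in> S)" for w
  proof (cases "w \<in> J")
    case True
    then have [measurable]: "w \<in> {1..n}" using assms by blast
    show ?thesis by measurable
  qed simp
  show ?thesis unfolding few_points_event_def by measurable
qed

lemma prob_few_points_event_le:
  fixes S :: "('d::finite \<Rightarrow> nat) set"
  assumes "0 < m" "S \<subseteq> grid m" "J \<subseteq> {1..n}"
  shows "measure (uniform_points n) (few_points_event n J m S a)
    \<le> 2 ^ a * exp (- (real (card S) / real (m ^ CARD('d))) * real (card J) / 2)"
proof -
  have "{x :: real ^ 'd. cell_index m x \<in> S} \<in> sets borel" by measurable
  then show ?thesis
    using product_prob_space.prob_few_points_le[OF product_prob_space_unit_cube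
        finite_atLeastAtMost assms(3), of "\<lambda>_. {x. cell_index m x \<in> S}",
        OF _ measure_cells_ge[OF assms(1,2)]]
    by (simp add: few_points_event_def uniform_points_def)
qed

lemma prob_few_points_event_half_le:
  fixes S :: "('d::finite \<Rightarrow> nat) set"
  assumes "0 < f" "0 < m" "J \<subseteq> {1..n}" "S \<subseteq> grid m"
    and card_S: "card S = m ^ CARD('d) div (2 * f) + 1"
    and "\<delta> \<le> real (card J)"
  shows "measure (uniform_points n) (few_points_event n J m S (a * card S))
    \<le> 2 ^ (a * m ^ CARD('d)) * exp (- \<delta> / (4 * real f))"
proof -
  define M where "M = m ^ CARD('d)"
  have "0 < M" using \<open>0 < m\<close> by (simp add: M_def)
  have "card S \<le> M" using card_mono[OF finite_grid \<open>S \<subseteq> grid m\<close>] by (simp add: card_grid M_def)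
  have "M < 2 * f * card S"
    using \<open>0 < f\<close> dividend_less_times_div[of "2 * f" M] by (simp add: card_S M_def)
  then have "real M \<le> real (2 * f * card S)" by (simp only: of_nat_le_iff less_imp_le)
  then have half: "1 / (2 * real f) \<le> real (card S) / real M"
    using \<open>0 < f\<close> \<open>0 < M\<close> by (simp add: field_simps)
  have "\<delta> / (4 * real f) \<le> 1 / (2 * real f) * real (card J) / 2"
    using \<open>\<delta> \<le> real (card J)\<close> by (simp add: divide_right_mono)
  also have "\<dots> \<le> real (card S) / real M * real (card J) / 2"
    using half by (intro divide_right_mono mult_right_mono) auto
  finally have "exp (- (real (card S) / real M) * real (card J) / 2) \<le> exp (- \<delta> / (4 * real f))"
    by simp
  moreover have "(2 :: real) ^ (a * card S) \<le> 2 ^ (a * M)"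
    using \<open>card S \<le> M\<close> by (intro power_increasing) auto
  ultimately show ?thesis
    using prob_few_points_event_le[OF \<open>0 < m\<close> \<open>S \<subseteq> grid m\<close> \<open>J \<subseteq> {1..n}\<close>, of "a * card S"]
    unfolding M_def[symmetric] by (elim order_trans) (intro mult_mono, auto)
qed

section \<open>Above the threshold\<close>

lemma clique_tiling_if_cells_populated:
  fixes x :: "nat \<Rightarrow> real ^ 'd"
  assumes "0 < f" "f dvd n" "0 < m" "real CARD('d) / real m \<le> r"
    and cube: "\<And>i. i \<in> {1..n} \<Longrightarrow> x i \<in> cbox 0 1"
    and populated: "\<And>v S. v \<in> {1..n} \<Longrightarrow> S \<subseteq> grid m \<Longrightarrow> card S = m ^ CARD('d) div (2 * f) + 1 \<Longrightarrow>
      2 * f\<^sup>2 * card S \<le> card {w \<in> neighbours {1..n} E v. cell_index m (x w) \<in> S}"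
  shows "clique_tiling f (E \<union> geometric_edges n r x) {1..n}"
proof (rule clique_tiling_of_boxes[where box_of = "\<lambda>v. cell_index m (x v)" and B = "grid m"])
  fix v w assume vw: "v \<in> {1..n}" "w \<in> {1..n}" "cell_index m (x v) = cell_index m (x w)" "v \<noteq> w"
  then have "norm (x v - x w) \<le> r"
    using norm_le_if_same_cell[OF \<open>0 < m\<close> cube[of v] cube[of w]] assms(4) by linarith
  then show "{v, w} \<in> E \<union> geometric_edges n r x"
    using doubleton_in_geometric_edges vw by blast
next
  fix v assume v: "v \<in> {1..n}"
  let ?N = "\<lambda>k. neighbours {w \<in> {1..n}. cell_index m (x w) = k} (E \<union> geometric_edges n r x) v"
  let ?N\<^sub>E = "\<lambda>k. {w \<in> neighbours {1..n} E v. cell_index m (x w) = k}"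
  have "card (?N\<^sub>E k) \<le> card (?N k)" for k
    by (intro card_mono) (auto simp: neighbours_def)
  then have "{k \<in> grid m. card (?N k) < 2 * f\<^sup>2} \<subseteq> {k \<in> grid m. card (?N\<^sub>E k) < 2 * f\<^sup>2}"
    by (auto intro: le_less_trans)
  then have "card {k \<in> grid m. card (?N k) < 2 * f\<^sup>2} \<le> card {k \<in> grid m. card (?N\<^sub>E k) < 2 * f\<^sup>2}"
    by (intro card_mono) (simp_all add: finite_grid)
  also have "\<dots> < m ^ CARD('d) div (2 * f) + 1"
    using populated[OF v] by (intro card_sparse_fibres_less) (auto simp: neighbours_def)
  finally have "card {k \<in> grid m. card (?N k) < 2 * f\<^sup>2} \<le> m ^ CARD('d) div (2 * f)" by simp
  then show "2 * f * card {k \<in> grid m. card (?N k) < 2 * f\<^sup>2} \<le> card (grid m :: ('d \<Rightarrow> nat) set)"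
    using \<open>0 < f\<close> by (simp add: card_grid less_eq_div_iff_mult_less_eq mult.commute)
qed (use assms(1-3) cell_index_in_grid in \<open>auto simp: finite_grid\<close>)

lemma AE_clique_tiling_or_few_points:
  assumes "0 < f" "f dvd n" "0 < m" "real CARD('d) / real m \<le> r"
  defines "q \<equiv> m ^ CARD('d) div (2 * f) + 1"
  shows "AE x in (uniform_points n :: (nat \<Rightarrow> real ^ 'd) measure).
    clique_tiling f (E \<union> geometric_edges n r x) {1..n} \<or>
    x \<in> (\<Union>(v, S)\<in>{1..n} \<times> {S. S \<subseteq> grid m \<and> card S = q}.
          few_points_event n (neighbours {1..n} E v) m S (2 * f\<^sup>2 * q))"
  using AE_uniform_points_in_cube[of n] AE_space
proof eventually_elim
  case (elim x)
  show ?case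
  proof (rule disjCI, rule clique_tiling_if_cells_populated[OF assms(1-4)])
    fix v and S :: "('d \<Rightarrow> nat) set"
    assume "x \<notin> (\<Union>(v, S)\<in>{1..n} \<times> {S. S \<subseteq> grid m \<and> card S = q}.
          few_points_event n (neighbours {1..n} E v) m S (2 * f\<^sup>2 * q))"
      and "v \<in> {1..n}" "S \<subseteq> grid m" "card S = m ^ CARD('d) div (2 * f) + 1"
    then have "x \<notin> few_points_event n (neighbours {1..n} E v) m S (2 * f\<^sup>2 * card S)"
      by (auto simp: q_def)
    then show "2 * f\<^sup>2 * card S \<le> card {w \<in> neighbours {1..n} E v. cell_index m (x w) \<in> S}"
      using elim by (auto simp: few_points_event_def)
  qed (use elim in blast)
qed

lemma perturbed_prob_clique_tiling_ge:
  assumes "0 < f" "f dvd n" "0 < m" "real CARD('d) / real m \<le> r"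
    and deg: "\<And>v. v \<in> {1..n} \<Longrightarrow> \<delta> \<le> real (card (neighbours {1..n} E v))"
  shows "1 - real n * 2 ^ ((2 * f\<^sup>2 + 1) * m ^ CARD('d)) * exp (- \<delta> / (4 * real f))
    \<le> perturbed_prob TYPE('d::finite) (\<lambda>V E. clique_tiling f E V) E n r"
proof -
  let ?U = "uniform_points n :: (nat \<Rightarrow> real ^ 'd) measure"
  interpret prob_space ?U by (rule prob_space_uniform_points)
  define q where "q = m ^ CARD('d) div (2 * f) + 1"
  define P where "P = {1..n} \<times> {S :: ('d \<Rightarrow> nat) set. S \<subseteq> grid m \<and> card S = q}"
  define A where "A = (\<lambda>(v, S :: ('d \<Rightarrow> nat) set).
    few_points_event n (neighbours {1..n} E v) m S (2 * f\<^sup>2 * q))"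
  define c where "c = 2 ^ (2 * f\<^sup>2 * m ^ CARD('d)) * exp (- \<delta> / (4 * real f))"
  have N: "neighbours {1..n} E v \<subseteq> {1..n}" for v by (auto simp: neighbours_def)
  have A_sets: "A p \<in> events" for p
    unfolding A_def case_prod_beta by (intro sets_few_points_event N)
  have A_le: "prob (A p) \<le> c" if p_in: "p \<in> P" for p
  proof -
    obtain v S where vS: "p = (v, S)" "v \<in> {1..n}" "S \<subseteq> grid m" "card S = q"
      using p_in by (auto simp: P_def)
    show ?thesis
      using prob_few_points_event_half_le[OF assms(1,3) N vS(3) _ deg[OF vS(2)], of "2 * f\<^sup>2"] vS(4)
      by (simp only: vS(1) A_def c_def q_def prod.case)
  qed
  have "finite P" unfolding P_def by (intro finite_cartesian_product finite_grid_subsets) simp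
  have "card P \<le> n * 2 ^ m ^ CARD('d)"
    by (simp add: P_def card_cartesian_product card_grid_subsets_le)
  have "1 - perturbed_prob TYPE('d) (\<lambda>V E. clique_tiling f E V) E n r
      = \<P>(x in ?U. \<not> clique_tiling f (E \<union> geometric_edges n r x) {1..n})"
    unfolding perturbed_prob_def by (intro prob_neg[symmetric] sets_geometric_edges_event)
  also have "\<dots> \<le> prob (\<Union>p\<in>P. A p)"
  proof (rule finite_measure_mono_AE)
    show "AE x in ?U. x \<in> {x \<in> space ?U. \<not> clique_tiling f (E \<union> geometric_edges n r x) {1..n}}
        \<longrightarrow> x \<in> (\<Union>p\<in>P. A p)"
      using AE_clique_tiling_or_few_points[OF assms(1-4), of E]
      by eventually_elim (auto simp: P_def A_def q_def)
  qed (use \<open>finite P\<close> A_sets in auto)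
  also have "\<dots> \<le> (\<Sum>p\<in>P. prob (A p))"
    using \<open>finite P\<close> A_sets by (intro finite_measure_subadditive_finite) auto
  also have "\<dots> \<le> real (card P) * c" using A_le by (rule sum_bounded_above)
  also have "\<dots> \<le> real (n * 2 ^ m ^ CARD('d)) * c"
    using \<open>card P \<le> n * 2 ^ m ^ CARD('d)\<close> by (intro mult_right_mono of_nat_mono) (auto simp: c_def)
  also have "\<dots> = real n * 2 ^ ((2 * f\<^sup>2 + 1) * m ^ CARD('d)) * exp (- \<delta> / (4 * real f))"
    by (simp add: c_def power_add algebra_simps)
  finally show ?thesis by simp
qed

lemma grid_size_exists:
  fixes K :: real and n d :: nat
  assumes "0 < K" "K \<le> real n" "0 < d"
  obtains m :: nat where "0 < m" "real (m ^ d) \<le> real n / K"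
    "real d / real m \<le> 2 * real d * K powr (1 / real d) * real n powr (- 1 / real d)"
proof -
  define y where "y = (real n / K) powr (1 / real d)"
  have "0 < real n" using assms by linarith
  have "1 \<le> y" unfolding y_def using assms by (intro ge_one_powr_ge_zero) auto
  define m where "m = nat \<lfloor>y\<rfloor>"
  have m_bounds: "0 < m" "real m \<le> y" "y < real m + 1" using \<open>1 \<le> y\<close> unfolding m_def by linarith+
  then have "y \<le> 2 * real m" by linarith
  have "real (m ^ d) \<le> y ^ d" using m_bounds(2) by (simp add: power_mono)
  also have "\<dots> = real n / K"
    using assms \<open>0 < real n\<close> by (simp add: y_def powr_powr flip: powr_realpow)
  finally have "real (m ^ d) \<le> real n / K" .
  moreover have "real d / real m \<le> 2 * real d / y"
    using mult_left_mono[OF \<open>y \<le> 2 * real m\<close>, of "real d"] \<open>1 \<le> y\<close> m_bounds(1)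
    by (simp add: field_simps)
  moreover have "2 * real d / y = 2 * real d * K powr (1 / real d) * real n powr (- 1 / real d)"
    using assms \<open>0 < real n\<close> by (simp add: y_def powr_divide powr_minus_divide)
  ultimately show ?thesis using that m_bounds(1) by simp
qed

lemma perturbed_prob_clique_tiling_ge_exp:
  assumes "0 < f" "f dvd n" "0 < \<alpha>" "simple_graph {1..n} E"
    and min_deg: "\<alpha> * real n \<le> real (min_degree {1..n} E)"
  defines "K \<equiv> 8 * real f * (2 * (real f)\<^sup>2 + 1) / \<alpha>"
  assumes "K \<le> real n"
    and radius:
      "2 * real CARD('d) * K powr (1 / real CARD('d)) * real n powr (- 1 / real CARD('d)) \<le> r"
  shows "1 - real n * exp (- (\<alpha> * real n) / (8 * real f))
    \<le> perturbed_prob TYPE('d::finite) (\<lambda>V E. clique_tiling f E V) E n r"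
proof -
  let ?c = "\<alpha> * real n / (8 * real f)"
  have "0 < 2 * (real f)\<^sup>2 + 1" by (simp add: add_nonneg_pos)
  then have "0 < K" using \<open>0 < f\<close> \<open>0 < \<alpha>\<close> by (simp add: K_def)
  obtain m where grid_size: "0 < m" "real (m ^ CARD('d)) \<le> real n / K" "real CARD('d) / real m \<le> r"
    using grid_size_exists[OF \<open>0 < K\<close> \<open>K \<le> real n\<close> zero_less_card_finite] radius
    by (meson order_trans)
  have "real ((2 * f\<^sup>2 + 1) * m ^ CARD('d)) = (2 * (real f)\<^sup>2 + 1) * real (m ^ CARD('d))"
    by (simp add: distrib_right)
  also have "\<dots> \<le> (2 * (real f)\<^sup>2 + 1) * (real n / K)"
    using grid_size(2) by (intro mult_left_mono) auto
  also have "\<dots> = ?c" using \<open>0 < 2 * (real f)\<^sup>2 + 1\<close> by (simp add: K_def)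
  finally have cells: "real ((2 * f\<^sup>2 + 1) * m ^ CARD('d)) \<le> ?c" .
  have "(2 :: real) ^ ((2 * f\<^sup>2 + 1) * m ^ CARD('d)) \<le> exp 1 ^ ((2 * f\<^sup>2 + 1) * m ^ CARD('d))"
    using exp_ge_add_one_self[of 1] by (intro power_mono) auto
  also have "\<dots> \<le> exp ?c" using cells by (simp flip: exp_of_nat_mult)
  finally have "real n * 2 ^ ((2 * f\<^sup>2 + 1) * m ^ CARD('d)) * exp (- (\<alpha> * real n) / (4 * real f))
      \<le> real n * exp ?c * exp (- (\<alpha> * real n) / (4 * real f))"
    by (intro mult_right_mono mult_left_mono) auto
  also have "\<dots> = real n * exp (- (\<alpha> * real n) / (8 * real f))"
  proof -
    have "?c + - (\<alpha> * real n) / (4 * real f) = - (\<alpha> * real n) / (8 * real f)"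
      using \<open>0 < f\<close> by (simp add: field_simps)
    then show ?thesis by (simp only: mult.assoc flip: exp_add)
  qed
  finally have "1 - real n * exp (- (\<alpha> * real n) / (8 * real f))
      \<le> 1 - real n * 2 ^ ((2 * f\<^sup>2 + 1) * m ^ CARD('d)) * exp (- (\<alpha> * real n) / (4 * real f))"
    by simp
  also have "\<dots> \<le> perturbed_prob TYPE('d) (\<lambda>V E. clique_tiling f E V) E n r"
  proof (rule perturbed_prob_clique_tiling_ge[OF assms(1,2) grid_size(1,3)])
    show "\<alpha> * real n \<le> real (card (neighbours {1..n} E v))" if "v \<in> {1..n}" for v
      using min_deg min_degree_le_card_neighbours[OF assms(4) that] by linarith
  qed
  finally show ?thesis .
qed

lemma perturbed_prob_le_1: "perturbed_prob TYPE('d::finite) P E n r \<le> 1"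
  unfolding perturbed_prob_def by (intro prob_space.prob_le_1 prob_space_uniform_points)

lemma perturbed_prob_mono:
  assumes "\<And>E. P {1..n} E \<Longrightarrow> Q {1..n} E"
  shows "perturbed_prob TYPE('d::finite) P E n r \<le> perturbed_prob TYPE('d) Q E n r"
proof -
  interpret prob_space "uniform_points n :: (nat \<Rightarrow> real ^ 'd) measure"
    by (rule prob_space_uniform_points)
  show ?thesis
    unfolding perturbed_prob_def
    using assms by (intro finite_measure_mono sets_geometric_edges_event) auto
qed

lemma perturbed_prob_has_factor_tendsto_1:
  assumes F: "simple_graph VF EF" "VF \<noteq> {}" and dvd: "\<And>n. n \<in> N \<Longrightarrow> card VF dvd n" and "0 < \<alpha>"
    and H: "min_degree_sequence N \<alpha> H"
    and r_nonneg: "\<forall>n\<in>N. 0 \<le> r n"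
    and r_omega: "r \<in> \<omega>[inf sequentially (principal N)](\<lambda>n. real n powr (- 1 / real CARD('d)))"
  shows "((\<lambda>n. perturbed_prob TYPE('d::finite) (has_factor VF EF) (H n) n (r n)) \<longlongrightarrow> 1)
    (inf sequentially (principal N))"
proof (rule tendsto_sandwich)
  let ?F = "inf sequentially (principal N)"
  define f where "f = card VF"
  have "0 < f" using F by (simp add: f_def simple_graph_def card_gt_0_iff)
  define K where "K = 8 * real f * (2 * (real f)\<^sup>2 + 1) / \<alpha>"
  have "0 < K" using \<open>0 < f\<close> \<open>0 < \<alpha>\<close> by (simp add: K_def add_nonneg_pos)
  have in_N: "eventually (\<lambda>n. n \<in> N) ?F"
    unfolding eventually_inf_principal by simp
  have large: "eventually (\<lambda>n. K \<le> real n) ?F"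
    using filter_leD[OF inf_le1 eventually_ge_at_top[of "nat \<lceil>K\<rceil>"]]
    by (rule eventually_mono) linarith
  have radius: "eventually (\<lambda>n. (2 * real CARD('d) * K powr (1 / real CARD('d)))
      * norm (real n powr (- 1 / real CARD('d))) \<le> norm (r n)) ?F"
    using r_omega by (rule landau_omega.smallD) (use \<open>0 < K\<close> in simp)
  show "eventually (\<lambda>n. 1 - real n * exp (- (\<alpha> * real n) / (8 * real f))
      \<le> perturbed_prob TYPE('d) (has_factor VF EF) (H n) n (r n)) ?F"
    using in_N large radius
  proof eventually_elim
    case (elim n)
    have "1 - real n * exp (- (\<alpha> * real n) / (8 * real f))
        \<le> perturbed_prob TYPE('d) (\<lambda>V E. clique_tiling f E V) (H n) n (r n)"
      using elim dvd H r_nonneg \<open>0 < f\<close> \<open>0 < \<alpha>\<close>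
      by (intro perturbed_prob_clique_tiling_ge_exp)
        (auto simp: f_def K_def min_degree_sequence_def)
    also have "\<dots> \<le> perturbed_prob TYPE('d) (has_factor VF EF) (H n) n (r n)"
      using has_factor_if_clique_tiling[OF F] by (intro perturbed_prob_mono) (simp add: f_def)
    finally show ?case .
  qed
  show "eventually (\<lambda>n. perturbed_prob TYPE('d) (has_factor VF EF) (H n) n (r n) \<le> 1) ?F"
    by (intro always_eventually allI perturbed_prob_le_1)
  have "(\<lambda>n::nat. 1 - real n * exp (- (\<alpha> * real n) / (8 * real f))) \<longlonglongrightarrow> 1"
    using \<open>0 < \<alpha>\<close> \<open>0 < f\<close> by real_asymp
  then show "((\<lambda>n. 1 - real n * exp (- (\<alpha> * real n) / (8 * real f))) \<longlongrightarrow> 1) ?F"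
    by (rule tendsto_mono[OF inf_le1])
qed (rule tendsto_const)

section \<open>Colour classes\<close>

abbreviation colour_class :: "'b set \<Rightarrow> ('b \<Rightarrow> nat) \<Rightarrow> nat \<Rightarrow> 'b set" where
  "colour_class V c i \<equiv> {v \<in> V. c v = i}"

lemma proper_colouring_exists:
  assumes "simple_graph V E"
  shows "\<exists>k c. proper_colouring V E k c"
proof -
  have "finite V" "E \<subseteq> nsets V 2" using assms by (auto simp: simple_graph_def)
  from \<open>finite V\<close> obtain c :: "'a \<Rightarrow> nat" and n where "c ` V = {i. i < n}" and "inj_on c V"
    using finite_imp_inj_to_nat_seg by metis
  have "u \<noteq> v" if "{u, v} \<in> E" for u v
    using that \<open>E \<subseteq> nsets V 2\<close> doubleton_in_nsets_2[of u v V] by blast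
  then have "c u \<noteq> c v" if "u \<in> V" "v \<in> V" "{u, v} \<in> E" for u v
    using \<open>inj_on c V\<close> that by (simp add: inj_on_eq_iff)
  then have "proper_colouring V E n c"
    using \<open>c ` V = {i. i < n}\<close> by (auto simp: proper_colouring_def)
  then show ?thesis by blast
qed

lemma proper_colouring_chromatic_number:
  assumes "simple_graph V E"
  shows "\<exists>c. proper_colouring V E (chromatic_number V E) c"
  using proper_colouring_exists[OF assms] unfolding chromatic_number_def by (rule LeastI_ex)

lemma colour_class_nonempty:
  assumes colouring: "proper_colouring V E (chromatic_number V E) c" and "i < chromatic_number V E"
  shows "colour_class V c i \<noteq> {}"
proof
  assume empty: "colour_class V c i = {}"
  let ?k = "chromatic_number V E"
  let ?c = "\<lambda>v. if c v = ?k - 1 then i else c v"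
  have "proper_colouring V E (?k - 1) ?c"
    unfolding proper_colouring_def
  proof (intro conjI ballI impI)
    fix v assume "v \<in> V"
    then have "c v < ?k" "c v \<noteq> i" using colouring empty by (auto simp: proper_colouring_def)
    then show "?c v < ?k - 1" using \<open>i < chromatic_number V E\<close> by auto
  next
    fix u v assume "u \<in> V" "v \<in> V" "{u, v} \<in> E"
    then have "c u \<noteq> c v" "c u \<noteq> i" "c v \<noteq> i"
      using colouring empty by (auto simp: proper_colouring_def)
    then show "?c u \<noteq> ?c v" by auto
  qed
  then have "?k \<le> ?k - 1" unfolding chromatic_number_def by (intro Least_le) blast
  then show False using \<open>i < chromatic_number V E\<close> by simp
qed

lemma smallest_class_le:
  assumes "proper_colouring V E (chromatic_number V E) c" "i < chromatic_number V E"
  shows "smallest_class V E \<le> card (colour_class V c i)"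
proof -
  have "smallest_class V E \<le> (MIN i\<in>{..<chromatic_number V E}. card (colour_class V c i))"
    unfolding smallest_class_def using assms(1) by (intro cINF_lower) auto
  also have "\<dots> \<le> card (colour_class V c i)" using assms(2) by (intro Min_le) auto
  finally show ?thesis .
qed

lemma smallest_class_attained:
  assumes "simple_graph V E" "0 < chromatic_number V E"
  obtains c i where "proper_colouring V E (chromatic_number V E) c" "i < chromatic_number V E"
    "card (colour_class V c i) = smallest_class V E"
proof -
  let ?k = "chromatic_number V E"
  have "smallest_class V E
      \<in> (\<lambda>c. MIN i\<in>{..<?k}. card (colour_class V c i)) ` {c. proper_colouring V E ?k c}"
    unfolding smallest_class_def
    using proper_colouring_chromatic_number[OF assms(1)] by (intro Inf_nat_def1) auto
  then obtain c where optimal: "proper_colouring V E ?k c"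
    "smallest_class V E = (MIN i\<in>{..<?k}. card (colour_class V c i))" by blast
  have "(MIN i\<in>{..<?k}. card (colour_class V c i)) \<in> (\<lambda>i. card (colour_class V c i)) ` {..<?k}"
    using assms(2) by (intro Min_in) auto
  then show ?thesis using that optimal by auto
qed

lemma smallest_class_bounds:
  assumes "simple_graph V E" "0 < chromatic_number V E"
  shows "0 < smallest_class V E"
    and "chromatic_number V E * smallest_class V E \<le> card V"
    and "chromatic_number V E - 1 + smallest_class V E \<le> card V"
proof -
  let ?k = "chromatic_number V E"
  have "finite V" using assms(1) by (simp add: simple_graph_def)
  obtain c i where c_proper: "proper_colouring V E ?k c" and "i < ?k"
    and class_i: "card (colour_class V c i) = smallest_class V E"
    using smallest_class_attained[OF assms] .
  have pos: "0 < card (colour_class V c j)" if "j < ?k" for j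
    using colour_class_nonempty[OF c_proper that] \<open>finite V\<close> by (simp add: card_gt_0_iff)
  show "0 < smallest_class V E" using pos[OF \<open>i < ?k\<close>] class_i by simp
  have card_V: "card V = (\<Sum>j<?k. card (colour_class V c j))"
    using \<open>finite V\<close> c_proper by (intro card_eq_sum_fibres) (auto simp: proper_colouring_def)
  have "(\<Sum>j<?k. smallest_class V E) \<le> (\<Sum>j<?k. card (colour_class V c j))"
    using smallest_class_le[OF c_proper] by (intro sum_mono) auto
  then show "?k * smallest_class V E \<le> card V" using card_V by simp
  have "(\<Sum>j\<in>{..<?k} - {i}. 1) \<le> (\<Sum>j\<in>{..<?k} - {i}. card (colour_class V c j))"
    using pos by (intro sum_mono) (auto simp: Suc_le_eq)
  moreover have "card V = card (colour_class V c i) + (\<Sum>j\<in>{..<?k} - {i}. card (colour_class V c j))"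
    unfolding card_V using \<open>i < ?k\<close> by (intro sum.remove) auto
  ultimately show "?k - 1 + smallest_class V E \<le> card V" using \<open>i < ?k\<close> class_i by simp
qed

lemma critical_chromatic_number_bounds:
  assumes "simple_graph V E" "chromatic_number V E \<ge> 2" "\<alpha> < 1 - 1 / critical_chromatic_number V E"
  shows "1 - real (smallest_class V E) / real (card V)
      < (1 - \<alpha>) * (real (chromatic_number V E) - 1)"
    and "real (smallest_class V E) / real (card V) \<le> 1 - \<alpha>"
    and "card V \<le> n \<Longrightarrow> 1 \<le> (1 - \<alpha>) * real n"
proof -
  let ?k = "real (chromatic_number V E)" and ?f = "real (card V)"
    and ?s = "real (smallest_class V E)"
  note bounds = smallest_class_bounds[OF assms(1)]
  have "1 < ?k" using assms(2) by simp
  have k_le: "?k - 1 \<le> ?f - ?s" using bounds(3) assms(2) by linarith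
  have "?k * ?s \<le> ?f" using bounds(2) assms(2) by (simp flip: of_nat_mult)
  then have ks_le: "(?k - 1) * ?s \<le> ?f - ?s" by (simp add: algebra_simps)
  have "0 < ?f" using k_le \<open>1 < ?k\<close> by linarith
  have "1 / critical_chromatic_number V E = (?f - ?s) / ((?k - 1) * ?f)"
    using \<open>1 < ?k\<close> k_le by (simp add: critical_chromatic_number_def)
  then have "(?f - ?s) / ((?k - 1) * ?f) < 1 - \<alpha>" using assms(3) by simp
  then have less: "?f - ?s < (?k - 1) * ((1 - \<alpha>) * ?f)"
    using \<open>1 < ?k\<close> \<open>0 < ?f\<close> by (simp add: pos_divide_less_eq mult_ac)
  then show "1 - ?s / ?f < (1 - \<alpha>) * (?k - 1)" using \<open>0 < ?f\<close> by (simp add: field_simps)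
  have cancel: "x \<le> (1 - \<alpha>) * ?f" if "(?k - 1) * x \<le> ?f - ?s" for x
    using le_less_trans[OF that less] \<open>1 < ?k\<close> by simp
  show s_le: "?s / ?f \<le> 1 - \<alpha>" using cancel[OF ks_le] \<open>0 < ?f\<close> by (simp add: pos_divide_le_eq)
  have "1 \<le> (1 - \<alpha>) * ?f" using cancel[of 1] k_le by simp
  moreover have "0 \<le> ?s / ?f" by simp
  then have "0 \<le> 1 - \<alpha>" using s_le by (rule order_trans)
  ultimately show "1 \<le> (1 - \<alpha>) * real n" if "card V \<le> n"
    using that by (meson mult_left_mono of_nat_mono order_trans)
qed

section \<open>Factors of perturbed multipartite graphs\<close>

definition complete_multipartite :: "'b set \<Rightarrow> ('b \<Rightarrow> nat) \<Rightarrow> 'b set set" where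
  "complete_multipartite V c = {e \<in> nsets V 2. inj_on c e}"

lemma doubleton_in_complete_multipartite:
  "{u, v} \<in> complete_multipartite V c \<longleftrightarrow> u \<in> V \<and> v \<in> V \<and> c u \<noteq> c v"
  by (auto simp: complete_multipartite_def)

lemma simple_graph_complete_multipartite:
  "finite V \<Longrightarrow> simple_graph V (complete_multipartite V c)"
  by (auto simp: simple_graph_def complete_multipartite_def)

lemma min_degree_complete_multipartite_ge:
  assumes "finite V" "V \<noteq> {}"
    and classes: "\<And>v. v \<in> V \<Longrightarrow> real (card (colour_class V c (c v))) \<le> (1 - \<alpha>) * real (card V)"
  shows "\<alpha> * real (card V) \<le> real (min_degree V (complete_multipartite V c))"
proof -
  let ?K = "complete_multipartite V c"
  have "min_degree V ?K \<in> degree ?K ` V"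
    unfolding min_degree_def using assms(1,2) by (intro Min_in) auto
  then obtain v where "v \<in> V" and v_min: "min_degree V ?K = degree ?K v" by blast
  have "degree ?K v = card (neighbours V ?K v)"
    using simple_graph_complete_multipartite[OF assms(1)] \<open>v \<in> V\<close>
    by (rule degree_eq_card_neighbours)
  also have "neighbours V ?K v = V - colour_class V c (c v)"
    using \<open>v \<in> V\<close> by (auto simp: neighbours_def doubleton_in_complete_multipartite)
  also have "card \<dots> = card V - card (colour_class V c (c v))"
    using assms(1) by (intro card_Diff_subset) auto
  finally have "real (card V) - real (card (colour_class V c (c v))) \<le> real (min_degree V ?K)"
    using v_min by linarith
  then show ?thesis using classes[OF \<open>v \<in> V\<close>] by (simp add: algebra_simps)
qed

lemma proper_colouring_sub_multipartite:
  assumes "D \<subseteq> complete_multipartite V c" "\<And>v. v \<in> W \<Longrightarrow> c v < k"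
  shows "proper_colouring W D k c"
  using assms by (auto simp: proper_colouring_def doubleton_in_complete_multipartite)

lemma isomorphic_copy_card: "isomorphic_copy VF EF W D \<Longrightarrow> card W = card VF"
  by (auto simp: isomorphic_copy_def dest: bij_betw_same_card)

lemma isomorphic_copy_edges:
  assumes "EF \<subseteq> nsets VF 2" "isomorphic_copy VF EF W D"
  shows "D \<subseteq> nsets W 2"
proof -
  obtain \<phi> where "bij_betw \<phi> VF W" "D = (\<lambda>e. \<phi> ` e) ` EF"
    using assms(2) by (auto simp: isomorphic_copy_def)
  then show ?thesis using bij_betw_nsets[of \<phi> VF W 2] assms(1) by (auto simp: bij_betw_def)
qed

lemma smallest_class_le_copy:
  assumes copy: "isomorphic_copy VF EF W D"
    and colouring: "proper_colouring W D (chromatic_number VF EF) c"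
    and "i < chromatic_number VF EF"
  shows "smallest_class VF EF \<le> card (colour_class W c i)"
proof -
  obtain \<phi> where \<phi>: "inj_on \<phi> VF" "\<phi> ` VF = W" "D = (\<lambda>e. \<phi> ` e) ` EF"
    using copy by (auto simp: isomorphic_copy_def bij_betw_def)
  have "\<phi> v \<in> W" if "v \<in> VF" for v using \<phi>(2) that by blast
  moreover have "{\<phi> u, \<phi> v} \<in> D" if "{u, v} \<in> EF" for u v
    using imageI[OF that, of "\<lambda>e. \<phi> ` e"] by (simp add: \<phi>(3))
  ultimately have "proper_colouring VF EF (chromatic_number VF EF) (c \<circ> \<phi>)"
    using colouring by (simp add: proper_colouring_def)
  then have "smallest_class VF EF \<le> card (colour_class VF (c \<circ> \<phi>) i)"
    using \<open>i < chromatic_number VF EF\<close> by (rule smallest_class_le)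
  also have "\<dots> = card (\<phi> ` colour_class VF (c \<circ> \<phi>) i)"
    using \<phi>(1) by (intro card_image[symmetric]) (auto simp: inj_on_def)
  also have "\<phi> ` colour_class VF (c \<circ> \<phi>) i = colour_class W c i" using \<phi>(2) by auto
  finally show ?thesis .
qed

lemma has_factorE:
  assumes "has_factor VF EF V E" "finite V" "VF \<noteq> {}" "finite VF"
  obtains C where "finite C" "disjoint_family_on fst C" "card V = card VF * card C"
    "\<And>p. p \<in> C \<Longrightarrow> fst p \<subseteq> V" "\<And>p. p \<in> C \<Longrightarrow> snd p \<subseteq> E"
    "\<And>p. p \<in> C \<Longrightarrow> isomorphic_copy VF EF (fst p) (snd p)"
proof -
  obtain C where C: "\<forall>p\<in>C. fst p \<subseteq> V \<and> snd p \<subseteq> E \<and> isomorphic_copy VF EF (fst p) (snd p)"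
    and disj: "disjoint_family_on fst C" and cover: "(\<Union>p\<in>C. fst p) = V"
    using assms(1) unfolding has_factor_def case_prod_beta by (elim exE conjE) (rule that)
  have card_copy: "card (fst p) = card VF" if "p \<in> C" for p
    using C that by (blast dest: isomorphic_copy_card)
  have nonempty: "fst p \<noteq> {}" if "p \<in> C" for p
    using card_copy[OF that] assms(3,4) by auto
  have "inj_on fst C"
  proof (rule inj_onI)
    fix p q assume "p \<in> C" "q \<in> C" "fst p = fst q"
    then show "p = q" using disjoint_family_onD[OF disj, of p q] nonempty[of p] by auto
  qed
  moreover have "fst ` C \<subseteq> Pow V" using C by blast
  then have "finite (fst ` C)" by (rule finite_subset) (simp add: \<open>finite V\<close>)
  ultimately have "finite C" by (simp add: finite_image_iff)
  have "card V = (\<Sum>p\<in>C. card (fst p))"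
    unfolding cover[symmetric] using \<open>finite C\<close> disj C \<open>finite V\<close>
    by (intro card_UN_disjoint') (auto intro: finite_subset)
  then have "card V = card VF * card C" using card_copy by simp
  with \<open>finite C\<close> disj C show ?thesis using that by blast
qed

lemma mult_card_le_card_disjoint_family:
  assumes "finite V" "disjoint_family_on A I" "\<And>i. i \<in> I \<Longrightarrow> A i \<subseteq> V" "\<And>i. i \<in> I \<Longrightarrow> t \<le> card (A i)"
  shows "t * card I \<le> card V"
proof (cases "finite I")
  case True
  have "t * card I \<le> (\<Sum>i\<in>I. card (A i))"
    using sum_mono[of I "\<lambda>_. t" "\<lambda>i. card (A i)"] assms(4) by (simp add: mult.commute)
  also have "\<dots> = card (\<Union>i\<in>I. A i)"
    using True assms(1-3) by (intro card_UN_disjoint'[symmetric]) (auto intro: finite_subset)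
  also have "\<dots> \<le> card V" using assms(1,3) by (intro card_mono) auto
  finally show ?thesis .
qed simp

lemma card_meeting_edge_set_le:
  fixes C :: "('a set \<times> 'a set set) set"
  assumes "disjoint_family_on fst C" "\<And>p. p \<in> C \<Longrightarrow> snd p \<subseteq> nsets (fst p) 2" "finite G"
  shows "card {p \<in> C. snd p \<inter> G \<noteq> {}} \<le> card G"
proof -
  define g where "g = (\<lambda>p :: 'a set \<times> 'a set set. SOME e. e \<in> snd p \<inter> G)"
  have g_in: "g p \<in> snd p \<inter> G" if "snd p \<inter> G \<noteq> {}" for p
    unfolding g_def some_in_eq using that .
  have "inj_on g {p \<in> C. snd p \<inter> G \<noteq> {}}"
  proof (rule inj_onI)
    fix p q assume pq: "p \<in> {p \<in> C. snd p \<inter> G \<noteq> {}}" "q \<in> {p \<in> C. snd p \<inter> G \<noteq> {}}" "g p = g q"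
    then have "g p \<in> nsets (fst p) 2" "g q \<in> nsets (fst q) 2"
      using g_in[of p] g_in[of q] assms(2)[of p] assms(2)[of q] by auto
    then have "g p \<noteq> {}" "g p \<subseteq> fst p" "g p \<subseteq> fst q"
      using pq(3) by (auto simp: nsets_def)
    then have "fst p \<inter> fst q \<noteq> {}" by blast
    then show "p = q" using disjoint_family_onD[OF assms(1), of p q] pq by auto
  qed
  then show ?thesis by (rule card_inj_on_le) (use g_in \<open>finite G\<close> in auto)
qed

text \<open>Copies of \<open>F\<close> inside the multipartite graph use at least \<open>smallest_class VF EF\<close> vertices of
  every class, and every other copy contains its own edge of \<open>G\<close>.\<close>

lemma factor_of_multipartite_Un:
  assumes F: "simple_graph VF EF" "VF \<noteq> {}" and "finite V" "finite G"
    and factor: "has_factor VF EF V (complete_multipartite V c \<union> G)"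
    and colours: "\<And>v. v \<in> V \<Longrightarrow> c v < chromatic_number VF EF" and "i < chromatic_number VF EF"
  shows "smallest_class VF EF * card V
    \<le> card VF * (card (colour_class V c i) + smallest_class VF EF * card G)"
proof -
  let ?s = "smallest_class VF EF"
  have "finite VF" and EF: "EF \<subseteq> nsets VF 2" using F by (auto simp: simple_graph_def)
  obtain C where C: "finite C" "disjoint_family_on fst C" "card V = card VF * card C"
    "\<And>p. p \<in> C \<Longrightarrow> fst p \<subseteq> V" "\<And>p. p \<in> C \<Longrightarrow> snd p \<subseteq> complete_multipartite V c \<union> G"
    "\<And>p. p \<in> C \<Longrightarrow> isomorphic_copy VF EF (fst p) (snd p)"
    using has_factorE[OF factor \<open>finite V\<close> F(2) \<open>finite VF\<close>] by blast
  define P where "P = {p \<in> C. snd p \<inter> G = {}}"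
  have P: "P \<subseteq> C" "finite P" using C(1) by (auto simp: P_def)
  have "?s * card P \<le> card (colour_class V c i)"
  proof (rule mult_card_le_card_disjoint_family[where A = "\<lambda>p. colour_class (fst p) c i"])
    show "disjoint_family_on (\<lambda>p. colour_class (fst p) c i) P"
      using C(2) P(1) unfolding disjoint_family_on_def by blast
    show "colour_class (fst p) c i \<subseteq> colour_class V c i" if "p \<in> P" for p
      using C(4)[of p] P(1) that by blast
    show "?s \<le> card (colour_class (fst p) c i)" if "p \<in> P" for p
    proof (rule smallest_class_le_copy[OF C(6)])
      show "proper_colouring (fst p) (snd p) (chromatic_number VF EF) c"
        using that C(4)[of p] C(5)[of p] colours
        by (intro proper_colouring_sub_multipartite[of _ V]) (auto simp: P_def)
    qed (use that \<open>i < chromatic_number VF EF\<close> in \<open>auto simp: P_def\<close>)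
  qed (simp add: \<open>finite V\<close>)
  moreover have "card (C - P) \<le> card G"
  proof -
    have "C - P = {p \<in> C. snd p \<inter> G \<noteq> {}}" by (auto simp: P_def)
    then show ?thesis
      using card_meeting_edge_set_le[OF C(2) isomorphic_copy_edges[OF EF C(6)] \<open>finite G\<close>] by simp
  qed
  moreover have "card C = card P + card (C - P)"
    using P C(1) by (simp add: card_Diff_subset card_mono)
  ultimately have "?s * card C \<le> card (colour_class V c i) + ?s * card G"
    by (simp add: distrib_left add_mono)
  then have "card VF * (?s * card C) \<le> card VF * (card (colour_class V c i) + ?s * card G)" by simp
  then show ?thesis by (simp only: C(3) mult.left_commute)
qed

lemma card_ge_if_small_class:
  assumes "simple_graph VF EF" "VF \<noteq> {}" "finite V" "finite G"
    and "has_factor VF EF V (complete_multipartite V c \<union> G)"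
    and "\<And>v. v \<in> V \<Longrightarrow> c v < chromatic_number VF EF" "i < chromatic_number VF EF"
    and small: "real (card (colour_class V c i)) \<le> \<mu> * real (card V)"
  shows "(real (smallest_class VF EF) / real (card VF) - \<mu>) * real (card V)
    \<le> real (smallest_class VF EF) * real (card G)"
proof -
  let ?s = "smallest_class VF EF"
  have "0 < card VF" using assms(1,2) by (simp add: simple_graph_def card_gt_0_iff)
  have "real (?s * card V) \<le> real (card VF * (card (colour_class V c i) + ?s * card G))"
    unfolding of_nat_le_iff using assms(1-7) by (rule factor_of_multipartite_Un)
  also have "\<dots> \<le> real (card VF) * (\<mu> * real (card V) + real ?s * real (card G))"
    using small by (simp add: mult_left_mono)
  finally show ?thesis using \<open>0 < card VF\<close> by (simp add: field_simps)
qed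

section \<open>Below the threshold\<close>

definition block_colour :: "nat \<Rightarrow> nat \<Rightarrow> nat \<Rightarrow> nat" where
  "block_colour m k v = min ((v - 1) div m) (k - 1)"

lemma block_colour_less: "0 < k \<Longrightarrow> block_colour m k v < k"
  by (simp add: block_colour_def min_def less_eq_iff_succ_less)

lemma card_block_le:
  assumes "0 < m" "i < k - 1"
  shows "card (colour_class {1..n} (block_colour m k) i) \<le> m"
proof -
  have "colour_class {1..n} (block_colour m k) i \<subseteq> {i * m + 1..i * m + m}"
  proof
    fix v assume v: "v \<in> colour_class {1..n} (block_colour m k) i"
    then have "(v - 1) div m = i"
      using assms by (auto simp: block_colour_def min_def split: if_splits)
    then have "i * m \<le> v - 1" "v - 1 < i * m + m"
      using mod_less_divisor[OF assms(1), of "v - 1"] div_mult_mod_eq[of "v - 1" m] by simp_all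
    then show "v \<in> {i * m + 1..i * m + m}" using v by auto
  qed
  then show ?thesis using card_mono[of "{i * m + 1..i * m + m}"] by fastforce
qed

lemma card_last_block_le:
  assumes "0 < m"
  shows "card (colour_class {1..n} (block_colour m k) (k - 1)) \<le> n - (k - 1) * m"
proof -
  have "colour_class {1..n} (block_colour m k) (k - 1) \<subseteq> {(k - 1) * m + 1..n}"
  proof
    fix v assume v: "v \<in> colour_class {1..n} (block_colour m k) (k - 1)"
    then have "k - 1 \<le> (v - 1) div m" by (auto simp: block_colour_def min_def split: if_splits)
    then have "(k - 1) * m \<le> v - 1" using assms by (simp add: less_eq_div_iff_mult_less_eq)
    then show "v \<in> {(k - 1) * m + 1..n}" using v by auto
  qed
  then show ?thesis using card_mono[of "{(k - 1) * m + 1..n}"] by fastforce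
qed

lemma block_colouring_exists:
  fixes k n :: nat and \<beta> \<mu> :: real
  assumes "2 \<le> k" "0 \<le> \<mu>" "\<mu> \<le> \<beta>"
    and large: "1 \<le> \<beta> * real n" "real k - 1 \<le> (\<beta> * (real k - 1) - (1 - \<mu>)) * real n"
  obtains c where "\<And>v. c v < k" "\<And>i. i < k \<Longrightarrow> real (card (colour_class {1..n} c i)) \<le> \<beta> * real n"
    "real (card (colour_class {1..n} c (k - 1))) \<le> \<mu> * real n"
proof
  define m where "m = nat \<lfloor>\<beta> * real n\<rfloor>"
  have m_bounds: "0 < m" "real m \<le> \<beta> * real n" "\<beta> * real n - 1 \<le> real m"
    using large(1) unfolding m_def by linarith+
  have "(1 - \<mu>) * real n \<le> (real k - 1) * (\<beta> * real n - 1)"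
    using large(2) by (simp add: algebra_simps)
  also have "\<dots> \<le> (real k - 1) * real m" using m_bounds(3) \<open>2 \<le> k\<close> by (intro mult_left_mono) auto
  also have "\<dots> = real ((k - 1) * m)" using \<open>2 \<le> k\<close> by (simp add: of_nat_diff)
  finally have "real n - real ((k - 1) * m) \<le> \<mu> * real n" by (simp add: algebra_simps)
  moreover have "0 \<le> \<mu> * real n" using \<open>0 \<le> \<mu>\<close> by simp
  ultimately have "real (n - (k - 1) * m) \<le> \<mu> * real n" by linarith
  then show last_class: "real (card (colour_class {1..n} (block_colour m k) (k - 1))) \<le> \<mu> * real n"
    using card_last_block_le[OF m_bounds(1), of n k] by linarith
  show "block_colour m k v < k" for v using \<open>2 \<le> k\<close> by (intro block_colour_less) simp
  show "real (card (colour_class {1..n} (block_colour m k) i)) \<le> \<beta> * real n" if "i < k" for i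
  proof (cases "i < k - 1")
    case True
    then show ?thesis using card_block_le[OF m_bounds(1) True, of n] m_bounds(2) by linarith
  next
    case False
    then have "i = k - 1" using that by simp
    moreover have "\<mu> * real n \<le> \<beta> * real n" using \<open>\<mu> \<le> \<beta>\<close> by (intro mult_right_mono) auto
    ultimately show ?thesis using last_class by simp
  qed
qed

definition requires_edges ::
  "('b set \<Rightarrow> 'b set set \<Rightarrow> bool) \<Rightarrow> 'b set \<Rightarrow> 'b set set \<Rightarrow> real \<Rightarrow> bool" where
  "requires_edges P V E t \<longleftrightarrow> (\<forall>G. finite G \<and> P V (E \<union> G) \<longrightarrow> t \<le> real (card G))"

lemma extremal_graph_exists:
  assumes F: "simple_graph VF EF" "chromatic_number VF EF \<ge> 2"
    and \<alpha>: "\<alpha> < 1 - 1 / critical_chromatic_number VF EF"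
  obtains \<epsilon> n0 where "0 < \<epsilon>"
    "\<And>n. n0 \<le> n \<Longrightarrow> \<exists>E. simple_graph {1..n} E \<and> \<alpha> * real n \<le> real (min_degree {1..n} E) \<and>
      requires_edges (has_factor VF EF) {1..n} E (\<epsilon> * real n)"
proof -
  define k where "k = chromatic_number VF EF"
  define f where "f = card VF"
  define s where "s = smallest_class VF EF"
  have "2 \<le> k" "0 < s" "s \<le> f"
    using F(2) smallest_class_bounds(1,3)[OF F(1)] by (auto simp: k_def s_def f_def)
  then have "VF \<noteq> {}" "0 < f" by (auto simp: f_def)
  note bounds = critical_chromatic_number_bounds[OF F \<alpha>, folded k_def f_def s_def]
  obtain \<mu> where \<mu>: "max 0 (1 - (1 - \<alpha>) * (real k - 1)) < \<mu>" "\<mu> < real s / real f"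
    using dense[of "max 0 (1 - (1 - \<alpha>) * (real k - 1))" "real s / real f"]
      bounds(1) \<open>0 < s\<close> \<open>0 < f\<close> by auto
  define \<gamma> where "\<gamma> = (1 - \<alpha>) * (real k - 1) - (1 - \<mu>)"
  have "0 < \<gamma>" using \<mu>(1) by (simp add: \<gamma>_def)
  have "0 < (real s / real f - \<mu>) / real s" using \<mu>(2) \<open>0 < s\<close> by simp
  then show ?thesis
  proof (rule that[of _ "max f (nat \<lceil>(real k - 1) / \<gamma>\<rceil>)"])
    fix n assume n_large: "max f (nat \<lceil>(real k - 1) / \<gamma>\<rceil>) \<le> n"
    then have "(real k - 1) / \<gamma> \<le> real n" by linarith
    then have "real k - 1 \<le> \<gamma> * real n"
      using \<open>0 < \<gamma>\<close> by (simp add: pos_divide_le_eq mult.commute)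
    then obtain c where colours: "\<And>v. c v < k"
      and classes: "\<And>i. i < k \<Longrightarrow> real (card (colour_class {1..n} c i)) \<le> (1 - \<alpha>) * real n"
      and last_class: "real (card (colour_class {1..n} c (k - 1))) \<le> \<mu> * real n"
      using block_colouring_exists[OF \<open>2 \<le> k\<close>, of \<mu> "1 - \<alpha>" n] \<mu> bounds n_large
      by (auto simp: \<gamma>_def)
    let ?E = "complete_multipartite {1..n} c"
    have "\<alpha> * real n \<le> real (min_degree {1..n} ?E)"
      using min_degree_complete_multipartite_ge[of "{1..n}" c \<alpha>] colours classes n_large \<open>0 < f\<close>
      by simp
    moreover have "(real s / real f - \<mu>) / real s * real n \<le> real (card G)"
      if "finite G" and factor: "has_factor VF EF {1..n} (?E \<union> G)" for G
    proof -
      have "(real s / real f - \<mu>) * real n \<le> real s * real (card G)"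
        using card_ge_if_small_class[OF F(1) \<open>VF \<noteq> {}\<close> _ \<open>finite G\<close> factor, of "k - 1" \<mu>]
          colours last_class \<open>2 \<le> k\<close> by (simp add: k_def f_def s_def)
      then show ?thesis using \<open>0 < s\<close> by (simp add: pos_divide_le_eq mult.commute)
    qed
    ultimately show "\<exists>E. simple_graph {1..n} E \<and> \<alpha> * real n \<le> real (min_degree {1..n} E) \<and>
        requires_edges (has_factor VF EF) {1..n} E ((real s / real f - \<mu>) / real s * real n)"
      using simple_graph_complete_multipartite[of "{1..n}" c] unfolding requires_edges_def by blast
  qed
qed

lemma dense_graph_exists:
  assumes "0 < n" "1 \<le> (1 - \<alpha>) * real n"
  shows "\<exists>E. simple_graph {1..n} E \<and> \<alpha> * real n \<le> real (min_degree {1..n} E)"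
proof -
  have "real (card (colour_class {1..n} id (id v))) \<le> (1 - \<alpha>) * real (card {1..n})"
    if "v \<in> {1..n}" for v
  proof -
    have "colour_class {1..n} id (id v) = {v}" using that by auto
    then show ?thesis using assms(2) by simp
  qed
  then show ?thesis
    using min_degree_complete_multipartite_ge[of "{1..n}" id \<alpha>] assms(1)
      simple_graph_complete_multipartite[of "{1..n}" id] by auto
qed

lemma extremal_sequence_exists:
  assumes F: "simple_graph VF EF" "chromatic_number VF EF \<ge> 2"
    and \<alpha>: "\<alpha> < 1 - 1 / critical_chromatic_number VF EF"
    and N_ge: "\<And>n. n \<in> N \<Longrightarrow> card VF \<le> n"
  obtains H \<epsilon> n0 where "min_degree_sequence N \<alpha> H" "0 < \<epsilon>"
    "\<And>n. n0 \<le> n \<Longrightarrow> requires_edges (has_factor VF EF) {1..n} (H n) (\<epsilon> * real n)"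
proof -
  obtain \<epsilon> n0 where "0 < \<epsilon>" and extremal:
    "\<And>n. n0 \<le> n \<Longrightarrow> \<exists>E. simple_graph {1..n} E \<and> \<alpha> * real n \<le> real (min_degree {1..n} E) \<and>
      requires_edges (has_factor VF EF) {1..n} E (\<epsilon> * real n)"
    using extremal_graph_exists[OF F \<alpha>] by blast
  have "\<exists>E. (n \<in> N \<longrightarrow> simple_graph {1..n} E \<and> \<alpha> * real n \<le> real (min_degree {1..n} E)) \<and>
      (n0 \<le> n \<longrightarrow> requires_edges (has_factor VF EF) {1..n} E (\<epsilon> * real n))" for n
  proof (cases "n0 \<le> n")
    case True
    then show ?thesis using extremal[OF True] by blast
  next
    case False
    have "\<exists>E. simple_graph {1..n} E \<and> \<alpha> * real n \<le> real (min_degree {1..n} E)" if "n \<in> N"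
    proof (rule dense_graph_exists)
      show "1 \<le> (1 - \<alpha>) * real n"
        using critical_chromatic_number_bounds(3)[OF F \<alpha>] N_ge[OF that] .
      then show "0 < n" by (cases n) auto
    qed
    with False show ?thesis by auto
  qed
  then obtain H where
    "\<And>n. n \<in> N \<Longrightarrow> simple_graph {1..n} (H n) \<and> \<alpha> * real n \<le> real (min_degree {1..n} (H n))"
    "\<And>n. n0 \<le> n \<Longrightarrow> requires_edges (has_factor VF EF) {1..n} (H n) (\<epsilon> * real n)"
    by metis
  with \<open>0 < \<epsilon>\<close> show ?thesis using that unfolding min_degree_sequence_def by blast
qed

lemma perturbed_prob_le_if_requires_edges:
  assumes "0 < \<epsilon>" "0 < n" "0 \<le> r"
    and requires: "requires_edges P {1..n} E (\<epsilon> * real n)"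
  shows "perturbed_prob TYPE('d::finite) P E n r
    \<le> (2 * (r / real n powr (- 1 / real CARD('d)))) ^ CARD('d) / \<epsilon>"
proof -
  interpret prob_space "uniform_points n :: (nat \<Rightarrow> real ^ 'd) measure"
    by (rule prob_space_uniform_points)
  define \<rho> where "\<rho> = real n powr (- 1 / real CARD('d))"
  have "\<rho> ^ CARD('d) = \<rho> powr real CARD('d)" using \<open>0 < n\<close> by (simp add: \<rho>_def powr_realpow)
  also have "\<dots> = real n powr (- 1)" by (simp add: \<rho>_def powr_powr)
  also have "\<dots> = 1 / real n" using \<open>0 < n\<close> by (simp add: powr_minus_divide)
  finally have \<rho>_power: "\<rho> ^ CARD('d) = 1 / real n" .
  have "perturbed_prob TYPE('d) P E n r
      \<le> \<P>(x in (uniform_points n :: (nat \<Rightarrow> real ^ 'd) measure).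
          \<epsilon> * real n \<le> real (card (geometric_edges n r x)))"
    unfolding perturbed_prob_def using requires finite_geometric_edges
    by (intro finite_measure_mono sets_geometric_edges_event) (auto simp: requires_edges_def)
  also have "\<dots> \<le> real (n choose 2) * (2 * r) ^ CARD('d) / (\<epsilon> * real n)"
    using assms(1-3) by (intro prob_many_edges_le) auto
  also have "\<dots> \<le> (real n)\<^sup>2 * (2 * r) ^ CARD('d) / (\<epsilon> * real n)"
  proof -
    have "n choose 2 \<le> n\<^sup>2" by (cases "2 \<le> n") (simp_all add: binomial_le_pow binomial_eq_0)
    then have "real (n choose 2) \<le> (real n)\<^sup>2" by (metis of_nat_le_iff of_nat_power)
    then show ?thesis using assms(1-3) by (intro divide_right_mono mult_right_mono) auto
  qed
  also have "\<dots> = (2 * (r / \<rho>)) ^ CARD('d) / \<epsilon>"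
    using \<open>0 < n\<close> \<open>0 < \<epsilon>\<close> by (simp add: power_divide power_mult_distrib \<rho>_power power2_eq_square)
  finally show ?thesis unfolding \<rho>_def .
qed

lemma perturbed_prob_tendsto_0:
  assumes "0 < \<epsilon>"
    and requires: "\<And>n. n0 \<le> n \<Longrightarrow> requires_edges P {1..n} (H n) (\<epsilon> * real n)"
    and r_nonneg: "\<forall>n\<in>N. 0 \<le> r n"
    and r_smallo: "r \<in> o[inf sequentially (principal N)](\<lambda>n. real n powr (- 1 / real CARD('d)))"
  shows "((\<lambda>n. perturbed_prob TYPE('d::finite) P (H n) n (r n)) \<longlongrightarrow> 0)
    (inf sequentially (principal N))"
proof (rule tendsto_sandwich)
  let ?F = "inf sequentially (principal N)"
  let ?b = "\<lambda>n. (2 * (r n / real n powr (- 1 / real CARD('d)))) ^ CARD('d) / \<epsilon>"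
  have "eventually (\<lambda>n. n \<in> N) ?F" by (simp add: eventually_inf_principal)
  moreover have "eventually (\<lambda>n. max 1 n0 \<le> n) ?F"
    using inf_le1 eventually_ge_at_top by (rule filter_leD)
  ultimately show "eventually (\<lambda>n. perturbed_prob TYPE('d) P (H n) n (r n) \<le> ?b n) ?F"
  proof eventually_elim
    case (elim n)
    then show ?case
      using \<open>0 < \<epsilon>\<close> r_nonneg requires by (intro perturbed_prob_le_if_requires_edges) auto
  qed
  show "eventually (\<lambda>n. 0 \<le> perturbed_prob TYPE('d) P (H n) n (r n)) ?F"
    unfolding perturbed_prob_def by simp
  have "((\<lambda>n. r n / real n powr (- 1 / real CARD('d))) \<longlongrightarrow> 0) ?F"
    using r_smallo by (rule smalloD_tendsto)
  then have "(?b \<longlongrightarrow> (2 * 0) ^ CARD('d) / \<epsilon>) ?F"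
    by (intro tendsto_intros) (use \<open>0 < \<epsilon>\<close> in auto)
  then show "(?b \<longlongrightarrow> 0) ?F" by (simp add: power_0_left)
qed (rule tendsto_const)

theorem theorem4p3:
  fixes VF :: "'a set" and EF :: "'a set set" and \<alpha> :: real
  assumes "simple_graph VF EF"
    and "chromatic_number VF EF \<ge> 2"
    and "0 < \<alpha>" and "\<alpha> < 1 - 1 / critical_chromatic_number VF EF"
  shows "perturbed_threshold TYPE('d::finite) {n. 0 < n \<and> card VF dvd n} \<alpha>
           (has_factor VF EF) (\<lambda>n. real n powr (- 1 / real CARD('d)))"
proof -
  let ?N = "{n. 0 < n \<and> card VF dvd n}" and ?\<rho> = "\<lambda>n. real n powr (- 1 / real CARD('d))"
  let ?F = "inf sequentially (principal ?N)"
  have "VF \<noteq> {}"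
    using smallest_class_bounds(1,3)[OF assms(1)] assms(2) by auto
  obtain H \<epsilon> n0 where H: "min_degree_sequence ?N \<alpha> H" and "0 < \<epsilon>"
    and requires: "\<And>n. n0 \<le> n \<Longrightarrow> requires_edges (has_factor VF EF) {1..n} (H n) (\<epsilon> * real n)"
    by (rule extremal_sequence_exists[OF assms(1,2,4), of ?N]) (auto simp: dvd_imp_le)
  show ?thesis
    unfolding perturbed_threshold_def
  proof (intro conjI allI impI exI[of _ H]; (elim conjE)?)
    show "((\<lambda>n. perturbed_prob TYPE('d) (has_factor VF EF) (H' n) n (r n)) \<longlongrightarrow> 1) ?F"
      if "min_degree_sequence ?N \<alpha> H'" "\<forall>n\<in>?N. 0 \<le> r n" "r \<in> \<omega>[?F](?\<rho>)" for H' r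
      using perturbed_prob_has_factor_tendsto_1[OF assms(1) \<open>VF \<noteq> {}\<close> _ assms(3) that] by simp
    show "((\<lambda>n. perturbed_prob TYPE('d) (has_factor VF EF) (H n) n (r n)) \<longlongrightarrow> 0) ?F"
      if "\<forall>n\<in>?N. 0 \<le> r n" "r \<in> o[?F](?\<rho>)" for r
      using \<open>0 < \<epsilon>\<close> requires that by (rule perturbed_prob_tendsto_0)
  qed (rule H)
qed

end
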